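(* Let $A$ be a finite-dimensional Hopf algebra over the field $\Bbbk$ with a normalized twist $J$. Let $R=\alpha(J^{-(1)})J^{-(2)}$. If $\lambda$ is a nonzero right integral in $A^*$, then $$\lambda^J:=\lambda\leftharpoonup S^2(R^{-1})S(Q_J^{-1})Q_J$$ is a nonzero right integral in $(A^J)^*$.
   Context: $\Bbbk$ is an arbitrary field; $A$ has comultiplication $\Delta(a)=a_{(1)}\otimes a_{(2)}$, counit $\varepsilon$, antipode $S$. A right integral $\lambda\in A^*$ satisfies $\lambda(b_{(1)})b_{(2)}=\lambda(b)1$ for all $b\in A$ (and similarly for $(A^J)^*$, using the comultiplication of $A^J$). For $a\in A$ and $\lambda\in A^*$, $\lambda\leftharpoonup a\in A^*$ is defined by $(\lambda\leftharpoonup a)(b)=\lambda(ab)$. The distinguished group-like element $\alpha\in A^*$ is the algebra map defined by $\Lambda a=\alpha(a)\Lambda$ for $a\in A$, where $\Lambda$ is a nonzero left integral of $A$ (i.e. $a\Lambda=\varepsilon(a)\Lambda$ for all $a$). A normalized twist for $A$ is an invertible $J\in A\otimes A$ with $(\varepsilon\otimes id)(J)=(id\otimes\varepsilon)(J)=1$ and $(\Delta\otimes id)(J)(J\otimes 1)=(id\otimes\Delta)(J)(1\otimes J)$. Write $J=J^{(1)}\otimes J^{(2)}$ and $J^{-1}=J^{-(1)}\otimes J^{-(2)}$ (summation understood). Put $Q_J=S(J^{(1)})J^{(2)}$, which is invertible with inverse $Q_J^{-1}=J^{-(1)}S(J^{-(2)})$; the element $R$ is invertible with $R^{-1}=\alpha(J^{(1)})J^{(2)}$.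 The twisted Hopf algebra $A^J$ has the same algebra structure and counit as $A$, comultiplication $\Delta^J(a)=J^{-1}\Delta(a)J$ and antipode $S^J(a)=Q_J^{-1}S(a)Q_J$. *)

theory Defs
  imports Complex_Main "HOL-Library.Poly_Mapping" "HOL-Algebra.Group"
begin

text \<open>
  Tensor powers are quotients of free vector spaces. The free vector space on a set of symbols
  \<open>'i\<close> is \<open>'i \<Rightarrow>\<^sub>0 'k\<close>, and the class of a formal sum \<open>p\<close> modulo a set of relations \<open>N\<close> is the
  coset of \<open>p\<close> with respect to the linear span of \<open>N\<close>.
\<close>

definition fscale :: "'k::field \<Rightarrow> ('i \<Rightarrow>\<^sub>0 'k) \<Rightarrow> ('i \<Rightarrow>\<^sub>0 'k)"
  where "fscale c p = Poly_Mapping.map (\<lambda>x. c * x) p"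

abbreviation fbasis :: "'i \<Rightarrow> ('i \<Rightarrow>\<^sub>0 'k::field)"
  where "fbasis x \<equiv> Poly_Mapping.single x 1"

definition fclass :: "('i \<Rightarrow>\<^sub>0 'k::field) set \<Rightarrow> ('i \<Rightarrow>\<^sub>0 'k) \<Rightarrow> ('i \<Rightarrow>\<^sub>0 'k) set"
  where "fclass N p = {q. q - p \<in> module.span fscale N}"

definition bilinear_relations ::
    "('k::field \<Rightarrow> 'a::ab_group_add \<Rightarrow> 'a) \<Rightarrow> ('a \<times> 'a \<Rightarrow>\<^sub>0 'k) set"
  where "bilinear_relations s =
      {fbasis (x + x', y) - fbasis (x, y) - fbasis (x', y) | x x' y. True}
    \<union> {fbasis (x, y + y') - fbasis (x, y) - fbasis (x, y') | x y y'. True}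
    \<union> {fbasis (s c x, y) - fscale c (fbasis (x, y)) | c x y. True}
    \<union> {fbasis (x, s c y) - fscale c (fbasis (x, y)) | c x y. True}"

definition trilinear_relations ::
    "('k::field \<Rightarrow> 'a::ab_group_add \<Rightarrow> 'a) \<Rightarrow> ('a \<times> 'a \<times> 'a \<Rightarrow>\<^sub>0 'k) set"
  where "trilinear_relations s =
      {fbasis (x + x', y, z) - fbasis (x, y, z) - fbasis (x', y, z) | x x' y z. True}
    \<union> {fbasis (x, y + y', z) - fbasis (x, y, z) - fbasis (x, y', z) | x y y' z. True}
    \<union> {fbasis (x, y, z + z') - fbasis (x, y, z) - fbasis (x, y, z') | x y z z'. True}
    \<union> {fbasis (s c x, y, z) - fscale c (fbasis (x, y, z)) | c x y z. True}
    \<union> {fbasis (x, s c y, z) - fscale c (fbasis (x, y, z)) | c x y z. True}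
    \<union> {fbasis (x, y, s c z) - fscale c (fbasis (x, y, z)) | c x y z. True}"

type_synonym ('k, 'a) tensor2 = "('a \<times> 'a \<Rightarrow>\<^sub>0 'k) set"
type_synonym ('k, 'a) tensor3 = "('a \<times> 'a \<times> 'a \<Rightarrow>\<^sub>0 'k) set"

definition class2 ::
    "('k::field \<Rightarrow> 'a::ab_group_add \<Rightarrow> 'a) \<Rightarrow> ('a \<times> 'a \<Rightarrow>\<^sub>0 'k) \<Rightarrow> ('k, 'a) tensor2"
  where "class2 s = fclass (bilinear_relations s)"

definition class3 ::
    "('k::field \<Rightarrow> 'a::ab_group_add \<Rightarrow> 'a) \<Rightarrow> ('a \<times> 'a \<times> 'a \<Rightarrow>\<^sub>0 'k) \<Rightarrow> ('k, 'a) tensor3"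
  where "class3 s = fclass (trilinear_relations s)"

definition some_rep :: "('i \<Rightarrow>\<^sub>0 'k::zero) set \<Rightarrow> ('i \<Rightarrow>\<^sub>0 'k)"
  where "some_rep X = (SOME p. p \<in> X)"

text \<open>
  \<open>tensor_sum t X f\<close> is the sum that Sweedler notation leaves implicit: if \<open>X\<close> is the class of
  \<open>\<Sum>\<^sub>i c\<^sub>i (x\<^sub>i, y\<^sub>i)\<close>, it is \<open>\<Sum>\<^sub>i c\<^sub>i f (x\<^sub>i, y\<^sub>i)\<close>, where \<open>t\<close> is the scalar multiplication of
  the target. For multilinear \<open>f\<close> the value does not depend on the representative; this is lemma
  \<open>tensor_sum_class2\<close> below for \<open>A \<otimes> A\<close>. When the result is to lie in a tensor power, the sum is
  formed in the free vector space and its class is taken afterwards.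
\<close>

definition lin_ext :: "('k::field \<Rightarrow> 'v::ab_group_add \<Rightarrow> 'v) \<Rightarrow> ('i \<Rightarrow> 'v) \<Rightarrow> ('i \<Rightarrow>\<^sub>0 'k) \<Rightarrow> 'v"
  where "lin_ext t f p = (\<Sum>x\<in>Poly_Mapping.keys p. t (Poly_Mapping.lookup p x) (f x))"

definition tensor_sum ::
    "('k::field \<Rightarrow> 'v::ab_group_add \<Rightarrow> 'v) \<Rightarrow> ('i \<Rightarrow>\<^sub>0 'k) set \<Rightarrow> ('i \<Rightarrow> 'v) \<Rightarrow> 'v"
  where "tensor_sum t X f = lin_ext t f (some_rep X)"

definition pure2 :: "('k::field \<Rightarrow> 'a::ab_group_add \<Rightarrow> 'a) \<Rightarrow> 'a \<Rightarrow> 'a \<Rightarrow> ('k, 'a) tensor2"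
  where "pure2 s x y = class2 s (fbasis (x, y))"

definition pure3 :: "('k::field \<Rightarrow> 'a::ab_group_add \<Rightarrow> 'a) \<Rightarrow> 'a \<Rightarrow> 'a \<Rightarrow> 'a \<Rightarrow> ('k, 'a) tensor3"
  where "pure3 s x y z = class3 s (fbasis (x, y, z))"

definition add2 ::
    "('k::field \<Rightarrow> 'a::ab_group_add \<Rightarrow> 'a) \<Rightarrow> ('k, 'a) tensor2 \<Rightarrow> ('k, 'a) tensor2 \<Rightarrow> ('k, 'a) tensor2"
  where "add2 s X Y = class2 s (some_rep X + some_rep Y)"

definition scale2 ::
    "('k::field \<Rightarrow> 'a::ab_group_add \<Rightarrow> 'a) \<Rightarrow> 'k \<Rightarrow> ('k, 'a) tensor2 \<Rightarrow> ('k, 'a) tensor2"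
  where "scale2 s c X = class2 s (fscale c (some_rep X))"

definition mult2 ::
    "('k::field \<Rightarrow> 'a::ring_1 \<Rightarrow> 'a) \<Rightarrow> ('k, 'a) tensor2 \<Rightarrow> ('k, 'a) tensor2 \<Rightarrow> ('k, 'a) tensor2"
  where "mult2 s X Y = class2 s
    (tensor_sum fscale X (\<lambda>(x, y). tensor_sum fscale Y (\<lambda>(x', y'). fbasis (x * x', y * y'))))"

definition mult3 ::
    "('k::field \<Rightarrow> 'a::ring_1 \<Rightarrow> 'a) \<Rightarrow> ('k, 'a) tensor3 \<Rightarrow> ('k, 'a) tensor3 \<Rightarrow> ('k, 'a) tensor3"
  where "mult3 s X Y = class3 s
    (tensor_sum fscale X (\<lambda>(x, y, z). tensor_sum fscale Y
      (\<lambda>(x', y', z'). fbasis (x * x', y * y', z * z'))))"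

definition tensor2_monoid :: "('k::field \<Rightarrow> 'a::ring_1 \<Rightarrow> 'a) \<Rightarrow> ('k, 'a) tensor2 monoid"
  where "tensor2_monoid s = \<lparr>carrier = range (class2 s), mult = mult2 s, one = pure2 s 1 1\<rparr>"

definition ring_monoid :: "'a::ring_1 monoid"
  where "ring_monoid = \<lparr>carrier = UNIV, mult = (*), one = 1\<rparr>"


text \<open>
  The underlying ring of a Hopf algebra is the type \<open>'a\<close>. Since the counit of a Hopf algebra
  satisfies \<open>\<epsilon>(1) = 1 \<noteq> 0\<close>, the condition \<open>1 \<noteq> 0\<close> in the class \<open>ring_1\<close> excludes nothing.
\<close>

record (overloaded) ('k, 'a) hopf =
  smul :: "'k \<Rightarrow> 'a \<Rightarrow> 'a"
  comul :: "'a \<Rightarrow> ('a \<times> 'a \<Rightarrow>\<^sub>0 'k) set"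
  counit :: "'a \<Rightarrow> 'k"
  antipode :: "'a \<Rightarrow> 'a"

definition comul_left :: "('k::field, 'a::ring_1) hopf \<Rightarrow> ('k, 'a) tensor2 \<Rightarrow> ('k, 'a) tensor3"
  \<comment> \<open>\<open>\<Delta> \<otimes> id\<close>\<close>
  where "comul_left H X = class3 (smul H)
    (tensor_sum fscale X (\<lambda>(x, y). tensor_sum fscale (comul H x) (\<lambda>(u, v). fbasis (u, v, y))))"

definition comul_right :: "('k::field, 'a::ring_1) hopf \<Rightarrow> ('k, 'a) tensor2 \<Rightarrow> ('k, 'a) tensor3"
  \<comment> \<open>\<open>id \<otimes> \<Delta>\<close>\<close>
  where "comul_right H X = class3 (smul H)
    (tensor_sum fscale X (\<lambda>(x, y). tensor_sum fscale (comul H y) (\<lambda>(u, v). fbasis (x, u, v))))"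

definition tensor_one_right :: "('k::field, 'a::ring_1) hopf \<Rightarrow> ('k, 'a) tensor2 \<Rightarrow> ('k, 'a) tensor3"
  \<comment> \<open>\<open>X \<mapsto> X \<otimes> 1\<close>\<close>
  where "tensor_one_right H X =
    class3 (smul H) (tensor_sum fscale X (\<lambda>(x, y). fbasis (x, y, 1)))"

definition tensor_one_left :: "('k::field, 'a::ring_1) hopf \<Rightarrow> ('k, 'a) tensor2 \<Rightarrow> ('k, 'a) tensor3"
  \<comment> \<open>\<open>X \<mapsto> 1 \<otimes> X\<close>\<close>
  where "tensor_one_left H X =
    class3 (smul H) (tensor_sum fscale X (\<lambda>(x, y). fbasis (1, x, y)))"

locale hopf_algebra =
  fixes H :: "('k::field, 'a::ring_1) hopf"
  assumes vector_space: "vector_space (smul H)"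
    and smul_mult_left: "smul H c x * y = smul H c (x * y)"
    and smul_mult_right: "x * smul H c y = smul H c (x * y)"
    and comul_in: "comul H x \<in> carrier (tensor2_monoid (smul H))"
    and comul_add: "comul H (x + y) = add2 (smul H) (comul H x) (comul H y)"
    and comul_smul: "comul H (smul H c x) = scale2 (smul H) c (comul H x)"
    and comul_mult: "comul H (x * y) = mult2 (smul H) (comul H x) (comul H y)"
    and comul_one: "comul H 1 = pure2 (smul H) 1 1"
    and linear_counit: "Vector_Spaces.linear (smul H) (*) (counit H)"
    and counit_mult: "counit H (x * y) = counit H x * counit H y"
    and counit_one: "counit H 1 = 1"
    and coassoc: "comul_left H (comul H x) = comul_right H (comul H x)"
    and counit_left: "tensor_sum (smul H) (comul H x) (\<lambda>(u, v). smul H (counit H u) v) = x"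
    and counit_right: "tensor_sum (smul H) (comul H x) (\<lambda>(u, v). smul H (counit H v) u) = x"
    and linear_antipode: "Vector_Spaces.linear (smul H) (smul H) (antipode H)"
    and antipode_left:
      "tensor_sum (smul H) (comul H x) (\<lambda>(u, v). antipode H u * v) = smul H (counit H x) 1"
    and antipode_right:
      "tensor_sum (smul H) (comul H x) (\<lambda>(u, v). u * antipode H v) = smul H (counit H x) 1"

locale finite_dimensional_hopf_algebra = hopf_algebra +
  assumes finite_dimensional: "\<exists>B. finite_dimensional_vector_space (smul H) B"

definition left_integral :: "('k::field, 'a::ring_1) hopf \<Rightarrow> 'a \<Rightarrow> bool"
  where "left_integral H \<Lambda> \<longleftrightarrow> (\<forall>a. a * \<Lambda> = smul H (counit H a) \<Lambda>)"

definition right_integral_dual :: "('k::field, 'a::ring_1) hopf \<Rightarrow> ('a \<Rightarrow> 'k) \<Rightarrow> bool"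
  where "right_integral_dual H \<phi> \<longleftrightarrow>
    Vector_Spaces.linear (smul H) (*) \<phi> \<and>
    (\<forall>b. tensor_sum (smul H) (comul H b) (\<lambda>(x, y). smul H (\<phi> x) y) = smul H (\<phi> b) 1)"

definition hit :: "('a::ring_1 \<Rightarrow> 'k) \<Rightarrow> 'a \<Rightarrow> 'a \<Rightarrow> 'k"
  \<comment> \<open>\<open>\<phi> \<leftharpoonup> a\<close>\<close>
  where "hit \<phi> a = (\<lambda>b. \<phi> (a * b))"

definition algebra_map :: "('k::field, 'a::ring_1) hopf \<Rightarrow> ('a \<Rightarrow> 'k) \<Rightarrow> bool"
  where "algebra_map H \<alpha> \<longleftrightarrow> Vector_Spaces.linear (smul H) (*) \<alpha> \<and>
    \<alpha> 1 = 1 \<and> (\<forall>a b. \<alpha> (a * b) = \<alpha> a * \<alpha> b)"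

text \<open>
  That \<open>\<alpha>\<close> is an algebra map is not part of the definition, because it follows from \<open>\<Lambda> \<noteq> 0\<close>:
  see \<open>distinguished_grouplike_algebra_map\<close>.
\<close>

definition distinguished_grouplike :: "('k::field, 'a::ring_1) hopf \<Rightarrow> ('a \<Rightarrow> 'k) \<Rightarrow> bool"
  where "distinguished_grouplike H \<alpha> \<longleftrightarrow>
    (\<exists>\<Lambda>. \<Lambda> \<noteq> 0 \<and> left_integral H \<Lambda> \<and> (\<forall>a. \<Lambda> * a = smul H (\<alpha> a) \<Lambda>))"

definition normalized_twist :: "('k::field, 'a::ring_1) hopf \<Rightarrow> ('k, 'a) tensor2 \<Rightarrow> bool"
  where "normalized_twist H J \<longleftrightarrow>
    J \<in> Units (tensor2_monoid (smul H)) \<and>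
    tensor_sum (smul H) J (\<lambda>(x, y). smul H (counit H x) y) = 1 \<and>
    tensor_sum (smul H) J (\<lambda>(x, y). smul H (counit H y) x) = 1 \<and>
    mult3 (smul H) (comul_left H J) (tensor_one_right H J) =
      mult3 (smul H) (comul_right H J) (tensor_one_left H J)"

definition twist_inv :: "('k::field, 'a::ring_1) hopf \<Rightarrow> ('k, 'a) tensor2 \<Rightarrow> ('k, 'a) tensor2"
  where "twist_inv H J = inv\<^bsub>tensor2_monoid (smul H)\<^esub> J"

definition twist_Q :: "('k::field, 'a::ring_1) hopf \<Rightarrow> ('k, 'a) tensor2 \<Rightarrow> 'a"
  where "twist_Q H J = tensor_sum (smul H) J (\<lambda>(x, y). antipode H x * y)"

definition twist_R :: "('k::field, 'a::ring_1) hopf \<Rightarrow> ('k, 'a) tensor2 \<Rightarrow> ('a \<Rightarrow> 'k) \<Rightarrow> 'a"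
  where "twist_R H J \<alpha> = tensor_sum (smul H) (twist_inv H J) (\<lambda>(x, y). smul H (\<alpha> x) y)"

definition twisted_hopf :: "('k::field, 'a::ring_1) hopf \<Rightarrow> ('k, 'a) tensor2 \<Rightarrow> ('k, 'a) hopf"
  where "twisted_hopf H J =
    \<lparr>smul = smul H,
     comul = (\<lambda>a. mult2 (smul H) (mult2 (smul H) (twist_inv H J) (comul H a)) J),
     counit = counit H,
     antipode = (\<lambda>a. inv\<^bsub>ring_monoid\<^esub> (twist_Q H J) * antipode H a * twist_Q H J)\<rparr>"


lemma lookup_fscale: "Poly_Mapping.lookup (fscale c p) x = c * Poly_Mapping.lookup p x"
  by (simp add: fscale_def Poly_Mapping.map.rep_eq when_def)

lemma vector_space_fscale: "vector_space fscale"
  by unfold_locales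
    (auto intro!: poly_mapping_eqI simp: lookup_fscale lookup_add algebra_simps)

lemma some_rep_fclass: "some_rep (fclass N p) \<in> fclass N p"
proof -
  interpret F: vector_space "fscale :: 'b \<Rightarrow> ('a \<Rightarrow>\<^sub>0 'b) \<Rightarrow> _" by (rule vector_space_fscale)
  have "p \<in> fclass N p"
    by (simp add: fclass_def F.span_zero)
  then show ?thesis
    unfolding some_rep_def by (rule someI)
qed

lemma lin_ext_superset:
  assumes "vector_space t" "finite A" "Poly_Mapping.keys p \<subseteq> A"
  shows "lin_ext t f p = (\<Sum>x\<in>A. t (Poly_Mapping.lookup p x) (f x))"
proof -
  interpret T: vector_space t by fact
  show ?thesis
    unfolding lin_ext_def using assms
    by (intro sum.mono_neutral_left) (auto simp: in_keys_iff)
qed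

lemma linear_lin_ext:
  assumes "vector_space t"
  shows "Vector_Spaces.linear fscale t (lin_ext t f)"
proof -
  interpret T: vector_space t by fact
  have add: "lin_ext t f (p + q) = lin_ext t f p + lin_ext t f q" for p q
  proof -
    let ?A = "Poly_Mapping.keys p \<union> Poly_Mapping.keys q"
    have "Poly_Mapping.keys (p + q) \<subseteq> ?A"
      by (rule Poly_Mapping.keys_add)
    then have "lin_ext t f (p + q) = (\<Sum>x\<in>?A. t (Poly_Mapping.lookup (p + q) x) (f x))"
      by (intro lin_ext_superset assms) auto
    also have "\<dots> = (\<Sum>x\<in>?A. t (Poly_Mapping.lookup p x) (f x))
        + (\<Sum>x\<in>?A. t (Poly_Mapping.lookup q x) (f x))"
      by (simp add: lookup_add T.scale_left_distrib sum.distrib)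
    also have "\<dots> = lin_ext t f p + lin_ext t f q"
      by (simp add: lin_ext_superset[OF assms, of ?A])
    finally show ?thesis .
  qed
  have scale: "lin_ext t f (fscale c p) = t c (lin_ext t f p)" for c p
  proof -
    have "Poly_Mapping.keys (fscale c p) \<subseteq> Poly_Mapping.keys p"
      by (auto simp: in_keys_iff lookup_fscale)
    then have "lin_ext t f (fscale c p) =
        (\<Sum>x\<in>Poly_Mapping.keys p. t (Poly_Mapping.lookup (fscale c p) x) (f x))"
      by (intro lin_ext_superset assms) auto
    then show ?thesis
      by (simp add: lin_ext_def lookup_fscale T.scale_sum_right)
  qed
  show ?thesis
    unfolding Vector_Spaces.linear_def module_hom_def module_hom_axioms_def
    using vector_space_fscale assms add scale
    by (auto simp: vector_space_def module_def)
qed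

lemma lin_ext_fbasis:
  assumes "vector_space t"
  shows "lin_ext t f (fbasis x) = f x"
proof -
  interpret T: vector_space t by fact
  show ?thesis by (simp add: lin_ext_def)
qed

lemma tensor_sum_fclass:
  assumes t: "vector_space t" and N: "\<And>r. r \<in> N \<Longrightarrow> lin_ext t f r = 0"
  shows "tensor_sum t (fclass N p) f = lin_ext t f p"
proof -
  interpret L: Vector_Spaces.linear fscale t "lin_ext t f" by (rule linear_lin_ext[OF t])
  have rep: "some_rep (fclass N p) - p \<in> module.span fscale N"
    using some_rep_fclass[of N p] by (simp add: fclass_def)
  have "lin_ext t f (some_rep (fclass N p) - p) = 0"
    by (rule L.eq_0_on_span[OF _ rep]) (rule N)
  then show ?thesis
    by (simp add: tensor_sum_def L.diff)
qed

lemma tensor_sum_class2: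
  assumes t: "vector_space t"
    and "\<And>y. Vector_Spaces.linear s t (\<lambda>x. f (x, y))"
    and "\<And>x. Vector_Spaces.linear s t (\<lambda>y. f (x, y))"
  shows "tensor_sum t (class2 s p) f = lin_ext t f p"
proof -
  interpret L: Vector_Spaces.linear fscale t "lin_ext t f" by (rule linear_lin_ext[OF t])
  interpret A: Vector_Spaces.linear s t "\<lambda>x. f (x, y)" for y by fact
  interpret B: Vector_Spaces.linear s t "\<lambda>y. f (x, y)" for x by fact
  show ?thesis
    unfolding class2_def
    by (rule tensor_sum_fclass[OF t])
      (auto simp: bilinear_relations_def L.diff L.scale lin_ext_fbasis[OF t]
        A.add B.add A.scale B.scale)
qed

lemma distinguished_grouplike_algebra_map:
  assumes H: "hopf_algebra H" and "distinguished_grouplike H \<alpha>"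
  shows "algebra_map H \<alpha>"
proof -
  interpret hopf_algebra H by fact
  interpret V: vector_space "smul H" by (rule vector_space)
  obtain \<Lambda> where L: "\<Lambda> \<noteq> 0" "\<And>a. \<Lambda> * a = smul H (\<alpha> a) \<Lambda>"
    using assms(2) by (auto simp: distinguished_grouplike_def)
  have eqI: "c = d" if "smul H c \<Lambda> = smul H d \<Lambda>" for c d
    using that L(1) by simp
  have "\<alpha> (a + b) = \<alpha> a + \<alpha> b" for a b
  proof (rule eqI)
    have "smul H (\<alpha> (a + b)) \<Lambda> = \<Lambda> * a + \<Lambda> * b"
      by (simp only: L(2)[symmetric] distrib_left)
    then show "smul H (\<alpha> (a + b)) \<Lambda> = smul H (\<alpha> a + \<alpha> b) \<Lambda>"
      by (simp only: L(2) V.scale_left_distrib)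
  qed
  moreover have "\<alpha> (smul H c a) = c * \<alpha> a" for a c
  proof (rule eqI)
    have "smul H (\<alpha> (smul H c a)) \<Lambda> = smul H c (\<Lambda> * a)"
      by (simp only: L(2)[symmetric] smul_mult_right)
    then show "smul H (\<alpha> (smul H c a)) \<Lambda> = smul H (c * \<alpha> a) \<Lambda>"
      by (simp only: L(2) V.scale_scale)
  qed
  moreover have "\<alpha> 1 = 1"
    by (rule eqI) (simp only: L(2)[symmetric] mult_1_right V.scale_one)
  moreover have "\<alpha> (a * b) = \<alpha> a * \<alpha> b" for a b
  proof (rule eqI)
    have "smul H (\<alpha> (a * b)) \<Lambda> = (\<Lambda> * a) * b"
      by (simp only: L(2)[symmetric] mult.assoc)
    also have "\<dots> = smul H (\<alpha> a * \<alpha> b) \<Lambda>"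
      by (simp add: L(2) smul_mult_left mult.commute)
    finally show "smul H (\<alpha> (a * b)) \<Lambda> = smul H (\<alpha> a * \<alpha> b) \<Lambda>" .
  qed
  moreover have "vector_space ((*) :: 'a \<Rightarrow> 'a \<Rightarrow> 'a)"
    by unfold_locales (auto simp: algebra_simps)
  ultimately show ?thesis
    using vector_space
    by (auto simp: algebra_map_def Vector_Spaces.linear_def module_hom_def module_hom_axioms_def
        vector_space_def module_def)
qed

end

theory Submission
  imports Defs
begin

text \<open>
  Write \<open>J = x \<otimes> y\<close> and \<open>J\<^sup>-\<^sup>1 = v \<otimes> z\<close> with summation understood, and put
  \<open>g = S(Q\<^sup>-\<^sup>1) Q\<close> and \<open>c = S\<^sup>2(R\<^sup>-\<^sup>1) g\<close>, so that the functional in question is \<open>\<phi> \<leftharpoonup> c\<close>.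
  Two facts carry the proof.

  The first is about \<open>\<phi>\<close>: there is an algebra map \<open>\<nu>(y) = \<alpha>(y\<^sub>1) S\<^sup>2(y\<^sub>2)\<close> of \<open>A\<close> with
  \<open>\<phi>(a y) = \<phi>(\<nu>(y) a)\<close> (\<open>integral_mult_commute\<close>). It is found by comparing both sides on the
  dual bases \<open>\<Lambda>\<^sub>1\<close>, \<open>S(\<Lambda>\<^sub>2)\<close> that a left integral \<open>\<Lambda>\<close> gives for the form \<open>\<phi>(a b)\<close>; this needs
  \<open>\<phi>\<close> to be nondegenerate and \<open>S\<close> to be bijective, both of which follow from the identity
  \<open>integral_antipode_comul\<close> and finite dimension.

  The second is about \<open>J\<close>: the cocycle equation gives
  \<open>\<Delta>(c) = (\<nu>(x) \<otimes> S\<^sup>2(y)) (c \<otimes> g) J\<^sup>-\<^sup>1\<close> (\<open>sw_comul_c\<close>). The factor \<open>S\<^sup>2(R\<^sup>-\<^sup>1)\<close> of \<open>c\<close> contributes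
  the twist by \<open>\<alpha>\<close>, and the factor \<open>g\<close> contributes the conjugation that \<open>Q\<close> causes
  (\<open>sw_comul_R'\<close>, \<open>sw_comul_g\<close>).

  Now let \<open>P = \<phi>(c v b\<^sub>1 x) z b\<^sub>2 y\<close> be the element that has to equal \<open>\<phi>(c b) 1\<close>. With
  \<open>u = \<nu>(x) c v\<close> the first fact turns it into \<open>P = \<phi>(u b\<^sub>1) z b\<^sub>2 y\<close>, and the integral property
  moves the coproduct from \<open>b\<close> to \<open>u\<close>: \<open>S(P) = \<phi>(u\<^sub>1 b) S(y) u\<^sub>2 S(z)\<close>. After the second fact is
  used for \<open>\<Delta>(c)\<close>, the cocycle equations for \<open>J\<close> and for \<open>J\<^sup>-\<^sup>1\<close> contract all sums
  (\<open>twist_contract\<close>, \<open>twist_inv_contract\<close>), and what remains is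
  \<open>\<phi>(c b) S(Q) g Q\<^sup>-\<^sup>1 = \<phi>(c b) 1\<close>. Since \<open>S\<close> is injective, \<open>P = \<phi>(c b) 1\<close>. The functional
  \<open>\<phi> \<leftharpoonup> c\<close> is nonzero because \<open>c\<close> is invertible.

  A Sweedler expression \<open>f(u, v)\<close> summed over a tensor \<open>X\<close> is written \<open>sw X (\<lambda>u v. f u v)\<close>.
  An equation between tensors is used in the form that its two sides agree under every
  multilinear \<open>f\<close> with values in \<open>A\<close>, so that each step of a hand computation is one rewriting
  step with an explicit linearity condition; \<open>lin_intros\<close> collects the rules that prove these
  conditions.
\<close>

section \<open>Tensors as functionals on multilinear maps\<close>

named_theorems lin_intros

lemma linear_tensor_sum:
  assumes "Vector_Spaces.linear t t' l"
  shows "l (tensor_sum t X f) = tensor_sum t' X (\<lambda>i. l (f i))"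
proof -
  interpret Vector_Spaces.linear t t' l by fact
  show ?thesis
    by (simp add: tensor_sum_def lin_ext_def sum scale)
qed

lemma tensor_sum_swap:
  assumes "vector_space t"
  shows "tensor_sum t X (\<lambda>i. tensor_sum t Y (\<lambda>j. f i j)) = tensor_sum t Y (\<lambda>j. tensor_sum t X (\<lambda>i. f i j))"
proof -
  interpret vector_space t by fact
  show ?thesis
    by (simp add: tensor_sum_def lin_ext_def scale_sum_right mult.commute) (rule sum.swap)
qed

lemma tensor_sum_class3:
  assumes t: "vector_space t"
    and "\<And>y z. Vector_Spaces.linear s t (\<lambda>x. f (x, y, z))"
    and "\<And>x z. Vector_Spaces.linear s t (\<lambda>y. f (x, y, z))"
    and "\<And>x y. Vector_Spaces.linear s t (\<lambda>z. f (x, y, z))"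
  shows "tensor_sum t (class3 s p) f = lin_ext t f p"
proof -
  interpret L: Vector_Spaces.linear fscale t "lin_ext t f" by (rule linear_lin_ext[OF t])
  interpret A: Vector_Spaces.linear s t "\<lambda>x. f (x, y, z)" for y z by fact
  interpret B: Vector_Spaces.linear s t "\<lambda>y. f (x, y, z)" for x z by fact
  interpret C: Vector_Spaces.linear s t "\<lambda>z. f (x, y, z)" for x y by fact
  show ?thesis
    unfolding class3_def
    by (rule tensor_sum_fclass[OF t])
      (auto simp: trilinear_relations_def L.diff L.scale lin_ext_fbasis[OF t]
        A.add B.add C.add A.scale B.scale C.scale)
qed

text \<open>
  Over a field, multilinear functions separate tensors. This is what makes an identity that has
  been tested on all bilinear maps an identity of tensors.
\<close>

lemma linear_separation:
  assumes "vector_space s" "p \<notin> module.span s N"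
  obtains f :: "_ \<Rightarrow> 'k::field" where
    "Vector_Spaces.linear s (*) f" "\<And>x. x \<in> N \<Longrightarrow> f x = 0" "f p \<noteq> 0"
proof -
  interpret V: vector_space s by fact
  have "vector_space ((*) :: 'k \<Rightarrow> 'k \<Rightarrow> 'k)"
    by unfold_locales (auto simp: algebra_simps)
  then interpret P: vector_space_pair s "(*) :: 'k \<Rightarrow> 'k \<Rightarrow> 'k"
    by (simp add: vector_space_pair_def assms)
  obtain B where B: "B \<subseteq> N" "V.independent B" "N \<subseteq> V.span B"
    using V.maximal_independent_subset by blast
  have p: "p \<notin> V.span B"
    using assms(2) B(1) V.span_mono by blast
  then have "V.independent (insert p B)"
    using B(2) by (auto simp: V.independent_insert)
  then obtain f where f: "Vector_Spaces.linear s (*) f" "\<forall>x\<in>insert p B. f x = (if x = p then 1 else 0)"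
    using P.linear_independent_extend[of "insert p B" "\<lambda>x. if x = p then 1 else 0"] by blast
  interpret F: Vector_Spaces.linear s "(*)" f by fact
  have "p \<notin> B" using p V.span_base by blast
  with f(2) have "f x = 0" if "x \<in> B" for x using that by auto
  then have "f x = 0" if "x \<in> N" for x
    using that B(3) F.eq_0_on_span by blast
  with f show ?thesis using that by auto
qed

context hopf_algebra
begin

sublocale V: vector_space "smul H"
  by (rule vector_space)

abbreviation scale (infixr "\<bullet>" 75) where "scale \<equiv> smul H"
abbreviation "\<Delta> \<equiv> comul H"
abbreviation "\<epsilon> \<equiv> counit H"
abbreviation "S \<equiv> antipode H"

text \<open>
  A Sweedler sum with values in \<open>A\<close> itself. Scalar-valued expressions occur in it as
  coefficients of elements of \<open>A\<close>, so this one target space is enough.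
\<close>

definition sw :: "('k, 'a) tensor2 \<Rightarrow> ('a \<Rightarrow> 'a \<Rightarrow> 'a) \<Rightarrow> 'a"
  where "sw X f = tensor_sum (smul H) X (\<lambda>(u, v). f u v)"

definition lin :: "('a \<Rightarrow> 'a) \<Rightarrow> bool"
  where "lin l \<longleftrightarrow> (\<forall>x y. l (x + y) = l x + l y) \<and> (\<forall>c x. l (c \<bullet> x) = c \<bullet> l x)"

definition functional :: "('a \<Rightarrow> 'k) \<Rightarrow> bool"
  where "functional f \<longleftrightarrow> Vector_Spaces.linear (smul H) (*) f"

definition bilin :: "('a \<Rightarrow> 'a \<Rightarrow> 'a) \<Rightarrow> bool"
  where "bilin f \<longleftrightarrow> (\<forall>y. lin (\<lambda>x. f x y)) \<and> (\<forall>x. lin (\<lambda>y. f x y))"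

definition trilin :: "('a \<Rightarrow> 'a \<Rightarrow> 'a \<Rightarrow> 'a) \<Rightarrow> bool"
  where "trilin f \<longleftrightarrow> (\<forall>y z. lin (\<lambda>x. f x y z)) \<and> (\<forall>x z. lin (\<lambda>y. f x y z))
    \<and> (\<forall>x y. lin (\<lambda>z. f x y z))"

lemma lin_linear: "lin l \<longleftrightarrow> Vector_Spaces.linear (smul H) (smul H) l"
  using vector_space
  by (auto simp: lin_def Vector_Spaces.linear_def module_hom_def module_hom_axioms_def
      vector_space_def module_def)

lemma functional_add: "functional f \<Longrightarrow> f (x + y) = f x + f y"
  and functional_scale: "functional f \<Longrightarrow> f (c \<bullet> x) = c * f x"
  and functional_0: "functional f \<Longrightarrow> f 0 = 0"
  and functional_sum: "functional f \<Longrightarrow> f (sum h A) = (\<Sum>x\<in>A. f (h x))"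
proof -
  assume "functional f"
  then interpret Vector_Spaces.linear "smul H" "(*)" f by (simp add: functional_def)
  show "f (x + y) = f x + f y" "f (c \<bullet> x) = c * f x" "f 0 = 0" "f (sum h A) = (\<Sum>x\<in>A. f (h x))"
    by (simp_all add: add scale zero sum)
qed

lemma lin_0: "lin l \<Longrightarrow> l 0 = 0"
  by (metis V.scale_zero_left lin_def)

lemma bilinI [lin_intros]:
  "(\<And>y. lin (\<lambda>x. f x y)) \<Longrightarrow> (\<And>x. lin (\<lambda>y. f x y)) \<Longrightarrow> bilin f"
  by (simp add: bilin_def)

lemma trilinI [lin_intros]:
  "(\<And>y z. lin (\<lambda>x. f x y z)) \<Longrightarrow> (\<And>x z. lin (\<lambda>y. f x y z)) \<Longrightarrow> (\<And>x y. lin (\<lambda>z. f x y z))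
    \<Longrightarrow> trilin f"
  by (simp add: trilin_def)

lemma lin_id [lin_intros]: "lin (\<lambda>x. x)"
  by (simp add: lin_def)

lemma lin_comp: "lin l \<Longrightarrow> lin h \<Longrightarrow> lin (\<lambda>x. l (h x))"
  by (simp add: lin_def)

lemma lin_bilin1: "bilin f \<Longrightarrow> lin h \<Longrightarrow> lin (\<lambda>x. f (h x) y)"
  and lin_bilin2: "bilin f \<Longrightarrow> lin h \<Longrightarrow> lin (\<lambda>x. f y (h x))"
  by (simp_all add: bilin_def lin_def)

lemma lin_trilin1: "trilin f \<Longrightarrow> lin h \<Longrightarrow> lin (\<lambda>x. f (h x) y z)"
  and lin_trilin2: "trilin f \<Longrightarrow> lin h \<Longrightarrow> lin (\<lambda>x. f y (h x) z)"
  and lin_trilin3: "trilin f \<Longrightarrow> lin h \<Longrightarrow> lin (\<lambda>x. f y z (h x))"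
  by (simp_all add: trilin_def lin_def)

lemma lin_antipode [lin_intros]: "lin h \<Longrightarrow> lin (\<lambda>x. S (h x))"
  using linear_antipode lin_comp[of S] by (simp add: lin_linear)

lemma lin_mult_left [lin_intros]: "lin h \<Longrightarrow> lin (\<lambda>x. h x * y)"
  by (simp add: lin_def smul_mult_left distrib_right)

lemma lin_mult_right [lin_intros]: "lin h \<Longrightarrow> lin (\<lambda>x. y * h x)"
  by (simp add: lin_def smul_mult_right distrib_left)

lemma lin_scale_right [lin_intros]: "lin h \<Longrightarrow> lin (\<lambda>x. c \<bullet> h x)"
  by (simp add: lin_def V.scale_right_distrib mult.commute)

lemma lin_functional: "functional f \<Longrightarrow> lin h \<Longrightarrow> lin (\<lambda>x. f (h x) \<bullet> y)"
  by (simp add: lin_def functional_add functional_scale V.scale_left_distrib)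

lemma functional_counit: "functional \<epsilon>"
  by (simp add: functional_def linear_counit)

lemmas lin_counit [lin_intros] = lin_functional[OF functional_counit]

lemma lin_sw [lin_intros]: "(\<And>u v. lin (\<lambda>x. f x u v)) \<Longrightarrow> lin (\<lambda>x. sw X (\<lambda>u v. f x u v))"
  by (auto simp: lin_def sw_def tensor_sum_def lin_ext_def case_prod_beta' sum.distrib
      V.scale_sum_right V.scale_right_distrib mult.commute)

lemma sw_lin: "lin l \<Longrightarrow> l (sw X f) = sw X (\<lambda>u v. l (f u v))"
  unfolding lin_linear sw_def by (simp add: linear_tensor_sum case_prod_beta')

text \<open>
  Nested sums commute for arbitrary \<open>f\<close>, because each is a sum over one fixed representative.
\<close>

lemma sw_swap: "sw X (\<lambda>u v. sw Y (\<lambda>a b. f u v a b)) = sw Y (\<lambda>a b. sw X (\<lambda>u v. f u v a b))"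
  unfolding sw_def case_prod_beta' by (rule tensor_sum_swap) (rule vector_space)

lemma sw_sum: "finite A \<Longrightarrow> sw X (\<lambda>u v. \<Sum>i\<in>A. f i u v) = (\<Sum>i\<in>A. sw X (f i))"
  by (simp add: sw_def tensor_sum_def lin_ext_def case_prod_beta' V.scale_sum_right) (rule sum.swap)

lemma sw_class2: "bilin f \<Longrightarrow> sw (class2 (smul H) p) f = lin_ext (smul H) (\<lambda>(u, v). f u v) p"
  unfolding sw_def
  by (rule tensor_sum_class2) (auto simp: vector_space bilin_def lin_linear)

lemma lin_ext_tensor_sum:
  "lin_ext (smul H) f (tensor_sum fscale X g) = tensor_sum (smul H) X (\<lambda>i. lin_ext (smul H) f (g i))"
  by (rule linear_tensor_sum) (rule linear_lin_ext[OF vector_space])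

lemma sw_mult2:
  assumes "bilin f"
  shows "sw (mult2 (smul H) X Y) f = sw X (\<lambda>a b. sw Y (\<lambda>c d. f (a * c) (b * d)))"
  unfolding mult2_def sw_class2[OF assms]
  by (simp add: lin_ext_tensor_sum lin_ext_fbasis[OF vector_space] case_prod_beta' sw_def)

lemma sw_pure2: "bilin f \<Longrightarrow> sw (pure2 (smul H) x y) f = f x y"
  by (simp add: pure2_def sw_class2 lin_ext_fbasis[OF vector_space])

lemma lin_sw_comul [lin_intros]:
  assumes "lin h" "bilin f"
  shows "lin (\<lambda>x. sw (\<Delta> (h x)) f)"
proof -
  interpret L: Vector_Spaces.linear fscale "smul H" "lin_ext (smul H) (\<lambda>(u, v). f u v)"
    by (rule linear_lin_ext[OF vector_space])
  show ?thesis
    using assms(1)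
    by (simp add: lin_def comul_add comul_smul add2_def scale2_def sw_class2[OF assms(2)]
        L.add L.scale) (simp add: sw_def tensor_sum_def)
qed

lemma sw_comul_mult:
  "bilin f \<Longrightarrow> sw (\<Delta> (x * y)) f = sw (\<Delta> x) (\<lambda>a b. sw (\<Delta> y) (\<lambda>c d. f (a * c) (b * d)))"
  by (simp add: comul_mult sw_mult2)

lemma sw_comul_one: "bilin f \<Longrightarrow> sw (\<Delta> 1) f = f 1 1"
  by (simp add: comul_one sw_pure2)

definition ev3 :: "('k, 'a) tensor3 \<Rightarrow> ('a \<Rightarrow> 'a \<Rightarrow> 'a \<Rightarrow> 'a) \<Rightarrow> 'a"
  where "ev3 X f = tensor_sum (smul H) X (\<lambda>(u, v, w). f u v w)"

lemma ev3_class3: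
  "trilin f \<Longrightarrow> ev3 (class3 (smul H) p) f = lin_ext (smul H) (\<lambda>(u, v, w). f u v w) p"
  unfolding ev3_def
  by (rule tensor_sum_class3) (auto simp: vector_space trilin_def lin_linear)

lemma ev3_mult3:
  assumes "trilin f"
  shows "ev3 (mult3 (smul H) X Y) f =
    ev3 X (\<lambda>a b c. ev3 Y (\<lambda>a' b' c'. f (a * a') (b * b') (c * c')))"
  unfolding mult3_def ev3_class3[OF assms]
  by (simp add: lin_ext_tensor_sum lin_ext_fbasis[OF vector_space] case_prod_beta' ev3_def)

lemma ev3_simps:
  assumes "trilin f"
  shows ev3_comul_left: "ev3 (comul_left H X) f = sw X (\<lambda>x y. sw (\<Delta> x) (\<lambda>u v. f u v y))"
    and ev3_comul_right: "ev3 (comul_right H X) f = sw X (\<lambda>x y. sw (\<Delta> y) (\<lambda>u v. f x u v))"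
    and ev3_one_right: "ev3 (tensor_one_right H X) f = sw X (\<lambda>x y. f x y 1)"
    and ev3_one_left: "ev3 (tensor_one_left H X) f = sw X (\<lambda>x y. f 1 x y)"
  unfolding comul_left_def comul_right_def tensor_one_right_def tensor_one_left_def
    ev3_class3[OF assms]
  by (simp_all add: lin_ext_tensor_sum lin_ext_fbasis[OF vector_space] case_prod_beta' sw_def)

lemma sw_coassoc:
  "trilin f \<Longrightarrow> sw (\<Delta> x) (\<lambda>u v. sw (\<Delta> u) (\<lambda>a b. f a b v)) = sw (\<Delta> x) (\<lambda>u v. sw (\<Delta> v) (\<lambda>a b. f u a b))"
  using arg_cong[OF coassoc[of x], of "\<lambda>X. ev3 X f"] by (simp add: ev3_simps)

lemma sw_counit_left: "lin l \<Longrightarrow> sw (\<Delta> x) (\<lambda>u v. \<epsilon> u \<bullet> l v) = l x"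
  using counit_left[of x] sw_lin[of l "\<Delta> x" "\<lambda>u v. \<epsilon> u \<bullet> v"] by (simp add: sw_def lin_def)

lemma sw_counit_right: "lin l \<Longrightarrow> sw (\<Delta> x) (\<lambda>u v. \<epsilon> v \<bullet> l u) = l x"
  using counit_right[of x] sw_lin[of l "\<Delta> x" "\<lambda>u v. \<epsilon> v \<bullet> u"] by (simp add: sw_def lin_def)

lemma sw_antipode_left: "lin l \<Longrightarrow> sw (\<Delta> x) (\<lambda>u v. l (S u * v)) = \<epsilon> x \<bullet> l 1"
  using antipode_left[of x] sw_lin[of l "\<Delta> x" "\<lambda>u v. S u * v"] by (simp add: sw_def lin_def)

lemma sw_antipode_right: "lin l \<Longrightarrow> sw (\<Delta> x) (\<lambda>u v. l (u * S v)) = \<epsilon> x \<bullet> l 1"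
  using antipode_right[of x] sw_lin[of l "\<Delta> x" "\<lambda>u v. u * S v"] by (simp add: sw_def lin_def)

lemma bilinear_relationsI:
  "fbasis (x + x', y) - fbasis (x, y) - fbasis (x', y) \<in> bilinear_relations s"
  "fbasis (x, y + y') - fbasis (x, y) - fbasis (x, y') \<in> bilinear_relations s"
  "fbasis (s c x, y) - fscale c (fbasis (x, y)) \<in> bilinear_relations s"
  "fbasis (x, s c y) - fscale c (fbasis (x, y)) \<in> bilinear_relations s"
  unfolding bilinear_relations_def
  by (rule UnI1, rule UnI1, rule UnI1, rule CollectI, (rule exI)+, rule conjI, (rule refl TrueI)+)
    (rule UnI1, rule UnI1, rule UnI2, rule CollectI, (rule exI)+, rule conjI, rule refl, rule TrueI,
      rule UnI1, rule UnI2, rule CollectI, (rule exI)+, rule conjI, rule refl, rule TrueI,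
      rule UnI2, rule CollectI, (rule exI)+, rule conjI, rule refl, rule TrueI)

text \<open>
  If two representatives differed modulo the bilinear relations, a linear functional that kills
  the relations would separate them, and such a functional is a bilinear map.
\<close>

lemma tensor2_eqI:
  assumes "X \<in> range (class2 (smul H))" "Y \<in> range (class2 (smul H))"
    and eq: "\<And>f. bilin f \<Longrightarrow> sw X f = sw Y f"
  shows "X = Y"
proof -
  obtain p q where p: "X = class2 (smul H) p" and q: "Y = class2 (smul H) q"
    using assms by blast
  let ?N = "bilinear_relations (smul H)"
  interpret F: vector_space fscale by (rule vector_space_fscale)
  have "p - q \<in> F.span ?N"
  proof (rule ccontr)
    assume "p - q \<notin> F.span ?N"
    then obtain h where h: "Vector_Spaces.linear fscale (*) h" "\<And>x. x \<in> ?N \<Longrightarrow> h x = 0" "h (p - q) \<noteq> 0"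
      using linear_separation[OF vector_space_fscale] by blast
    interpret h: Vector_Spaces.linear fscale "(*)" h by fact
    let ?f = "\<lambda>x y. h (fbasis (x, y)) \<bullet> 1"
    have rel: "h a = h b" if "a - b \<in> ?N" for a b
      using h(2)[OF that] by (simp add: h.diff)
    note rel = rel[OF bilinear_relationsI(1)[unfolded diff_diff_eq]] rel[OF bilinear_relationsI(2)[unfolded diff_diff_eq]]
      rel[OF bilinear_relationsI(3)] rel[OF bilinear_relationsI(4)]
    have f: "bilin ?f"
      by (simp add: rel bilin_def lin_def h.add h.scale V.scale_left_distrib)
    have "lin_ext (smul H) (\<lambda>(u, v). ?f u v) r = h r \<bullet> 1" for r
    proof -
      have "Vector_Spaces.linear fscale (smul H) (\<lambda>r. h r \<bullet> 1)"
        using vector_space F.vector_space_axioms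
        by (auto simp: Vector_Spaces.linear_def module_hom_def module_hom_axioms_def h.add h.scale
             V.scale_left_distrib vector_space_def module_def)
      then interpret g: Vector_Spaces.linear fscale "smul H" "\<lambda>r. h r \<bullet> 1" .
      have "r = (\<Sum>i\<in>Poly_Mapping.keys r. fscale (Poly_Mapping.lookup r i) (fbasis i))"
        by (rule poly_mapping_eqI)
          (simp add: lookup_sum lookup_fscale lookup_single when_def in_keys_iff
            if_distrib[of "\<lambda>x. _ * x"] sum.delta' cong: if_cong)
      from arg_cong[OF this, of "\<lambda>r. h r \<bullet> (1::'a)"]
      have "h r \<bullet> 1 = (\<Sum>i\<in>Poly_Mapping.keys r. Poly_Mapping.lookup r i \<bullet> (h (fbasis i) \<bullet> 1))"
        by (simp only: g.sum g.scale)
      then show ?thesis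
        by (simp add: lin_ext_def case_prod_beta')
    qed
    with eq[OF f] have "h p \<bullet> 1 = h q \<bullet> (1::'a)"
      by (simp only: p q sw_class2[OF f])
    then show False
      using h(3) by (simp add: h.diff)
  qed
  then show ?thesis
    unfolding p q class2_def fclass_def
    by (auto dest: F.span_add[of _ _ "p - q"] F.span_diff[of _ _ "p - q"])
qed

text \<open>
  The inverse of \<open>J\<close> is taken in this structure, and only associativity and unit laws make it
  a genuine two-sided inverse.
\<close>

lemma monoid_tensor2: "monoid (tensor2_monoid (smul H))"
proof -
  have c: "mult2 (smul H) X Y \<in> range (class2 (smul H))"
      "pure2 (smul H) x y \<in> range (class2 (smul H))" for X Y x y
    by (simp_all add: mult2_def pure2_def)
  have f: "bilin (\<lambda>a b. f (x * a) (y * b))" "bilin (\<lambda>a b. sw X (\<lambda>c d. f (a * c) (b * d)))"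
    if "bilin f" for f x y X
    by (intro lin_intros lin_bilin1[OF that] lin_bilin2[OF that])+
  have assoc: "mult2 (smul H) (mult2 (smul H) X Y) Z = mult2 (smul H) X (mult2 (smul H) Y Z)" for X Y Z
    by (rule tensor2_eqI[OF c(1) c(1)]) (simp only: sw_mult2 f mult.assoc)
  have one: "mult2 (smul H) (pure2 (smul H) 1 1) X = X" "mult2 (smul H) X (pure2 (smul H) 1 1) = X"
    if X: "X \<in> range (class2 (smul H))" for X
    by (rule tensor2_eqI[OF c(1) X]; simp only: sw_mult2 sw_pure2 f mult_1_left mult_1_right)+
  show ?thesis
    by (rule monoidI) (simp_all only: tensor2_monoid_def partial_object.simps monoid.simps c assoc one)
qed

end

section \<open>The antipode reverses products and coproducts\<close>

context hopf_algebra
begin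

lemma sw_cong: "(\<And>u v. f u v = g u v) \<Longrightarrow> sw X f = sw X g"
  by (simp add: sw_def)

lemma sw_scale: "sw X (\<lambda>u v. c \<bullet> f u v) = c \<bullet> sw X f"
  by (rule sw_lin[symmetric]) (intro lin_intros)

lemma sw_mult_left: "sw X f * y = sw X (\<lambda>u v. f u v * y)"
  by (rule sw_lin) (intro lin_intros)

lemma sw_mult_right: "y * sw X f = sw X (\<lambda>u v. y * f u v)"
  by (rule sw_lin) (intro lin_intros)

lemma sw_comul_sw: "bilin f \<Longrightarrow> sw (\<Delta> (sw X g)) f = sw X (\<lambda>u v. sw (\<Delta> (g u v)) f)"
  by (rule sw_lin) (rule lin_sw_comul[OF lin_id])

lemma lin_scale: "lin l \<Longrightarrow> l (c \<bullet> x) = c \<bullet> l x"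
  by (simp add: lin_def)

text \<open>
  The antipode axioms in the form in which they cancel two neighbouring tensor factors inside a
  larger expression.
\<close>

lemma sw_convolution_inverse:
  assumes f: "bilin f"
  shows sw_antipode_left1: "sw (\<Delta> x) (\<lambda>u v. sw (\<Delta> u) (\<lambda>a b. f (S a * b) v)) = f 1 x"
    and sw_antipode_left2: "sw (\<Delta> x) (\<lambda>u v. sw (\<Delta> v) (\<lambda>a b. f u (S a * b))) = f x 1"
    and sw_antipode_right1: "sw (\<Delta> x) (\<lambda>u v. sw (\<Delta> u) (\<lambda>a b. f (a * S b) v)) = f 1 x"
    and sw_antipode_right2: "sw (\<Delta> x) (\<lambda>u v. sw (\<Delta> v) (\<lambda>a b. f u (a * S b))) = f x 1"
proof -
  note [lin_intros] = lin_bilin1[OF f] lin_bilin2[OF f]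
  have l: "lin (\<lambda>a. f a v)" "lin (f u)" for u v
    using f by (simp_all add: bilin_def)
  show "sw (\<Delta> x) (\<lambda>u v. sw (\<Delta> u) (\<lambda>a b. f (S a * b) v)) = f 1 x"
    "sw (\<Delta> x) (\<lambda>u v. sw (\<Delta> v) (\<lambda>a b. f u (S a * b))) = f x 1"
    "sw (\<Delta> x) (\<lambda>u v. sw (\<Delta> u) (\<lambda>a b. f (a * S b) v)) = f 1 x"
    "sw (\<Delta> x) (\<lambda>u v. sw (\<Delta> v) (\<lambda>a b. f u (a * S b))) = f x 1"
    by (simp_all add: sw_antipode_left[of "\<lambda>a. f a _"] sw_antipode_left[of "f _"]
        sw_antipode_right[of "\<lambda>a. f a _"] sw_antipode_right[of "f _"] l sw_counit_left sw_counit_right)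
qed

lemma antipode_one: "S 1 = 1"
  using sw_antipode_left[of "\<lambda>x. x" 1] sw_comul_one[of "\<lambda>u v. S u * v"]
  by (simp add: lin_intros counit_one)

text \<open>
  Both \<open>S(x y)\<close> and \<open>S(y) S(x)\<close> are convolution inverses of the multiplication
  \<open>A \<otimes> A \<rightarrow> A\<close>: evaluate \<open>S(x\<^sub>1 y\<^sub>1) x\<^sub>2 y\<^sub>2 S(y\<^sub>3) S(x\<^sub>3)\<close> in two ways.
\<close>

lemma antipode_mult: "S (x * y) = S y * S x"
proof -
  have "S (x * y) = sw (\<Delta> x) (\<lambda>x1 x2. sw (\<Delta> x2) (\<lambda>p q. S (x1 * y) * (p * S q)))"
    by (subst sw_antipode_right2[where f = "\<lambda>a b. S (a * y) * b"]) (intro lin_intros, simp)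
  also have "\<dots> = sw (\<Delta> x) (\<lambda>x1 x2. sw (\<Delta> x2) (\<lambda>p q. sw (\<Delta> y) (\<lambda>y1 y2. sw (\<Delta> y2) (\<lambda>r s.
      S (x1 * y1) * (p * (r * S s) * S q)))))"
    by (subst sw_antipode_right2[where f = "\<lambda>a b. S (_ * a) * (_ * b * S _)"]) (intro lin_intros, simp)
  also have "\<dots> = sw (\<Delta> x) (\<lambda>x1 x2. sw (\<Delta> x2) (\<lambda>p q. sw (\<Delta> y) (\<lambda>y1 y2. sw (\<Delta> y1) (\<lambda>a b.
      S (x1 * a) * (p * (b * S y2) * S q)))))"
    by (rule sw_cong, rule sw_cong, rule sw_coassoc[symmetric], intro lin_intros)
  also have "\<dots> = sw (\<Delta> x) (\<lambda>x1 x2. sw (\<Delta> x1) (\<lambda>p q. sw (\<Delta> y) (\<lambda>y1 y2. sw (\<Delta> y1) (\<lambda>a b.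
      S (p * a) * (q * (b * S y2) * S x2)))))"
    by (rule sw_coassoc[symmetric], intro lin_intros)
  also have "\<dots> = sw (\<Delta> x) (\<lambda>x1 x2. sw (\<Delta> y) (\<lambda>y1 y2. sw (\<Delta> (x1 * y1)) (\<lambda>a b. (S a * b) * (S y2 * S x2))))"
    by (subst sw_comul_mult, intro lin_intros, subst (2) sw_swap) (simp add: mult.assoc)
  also have "\<dots> = sw (\<Delta> x) (\<lambda>x1 x2. sw (\<Delta> y) (\<lambda>y1 y2. \<epsilon> (x1 * y1) \<bullet> (S y2 * S x2)))"
    by (subst sw_antipode_left[where l = "\<lambda>a. a * _"]) (intro lin_intros, simp)
  also have "\<dots> = sw (\<Delta> x) (\<lambda>x1 x2. \<epsilon> x1 \<bullet> sw (\<Delta> y) (\<lambda>y1 y2. \<epsilon> y1 \<bullet> (S y2 * S x2)))"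
    by (simp add: sw_scale[symmetric] counit_mult)
  also have "\<dots> = S y * S x"
    by (simp add: sw_counit_left lin_intros)
  finally show ?thesis .
qed

text \<open>
  The map \<open>v \<mapsto> S(v\<^sub>2) \<otimes> S(v\<^sub>1)\<close> is a right convolution inverse of \<open>\<Delta>\<close>.
\<close>

lemma sw_comul_antipode_inverse:
  assumes h: "bilin h"
  shows "sw (\<Delta> v) (\<lambda>p q. sw (\<Delta> p) (\<lambda>a b. sw (\<Delta> q) (\<lambda>c d. h (a * S d) (b * S c)))) = \<epsilon> v \<bullet> h 1 1"
proof -
  note [lin_intros] = lin_bilin1[OF h] lin_bilin2[OF h]
  have "sw (\<Delta> v) (\<lambda>p q. sw (\<Delta> p) (\<lambda>a b. sw (\<Delta> q) (\<lambda>c d. h (a * S d) (b * S c))))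
     = sw (\<Delta> v) (\<lambda>a w. sw (\<Delta> w) (\<lambda>b q. sw (\<Delta> q) (\<lambda>c d. h (a * S d) (b * S c))))"
    by (rule sw_coassoc, intro lin_intros)
  also have "\<dots> = sw (\<Delta> v) (\<lambda>a w. sw (\<Delta> w) (\<lambda>t d. sw (\<Delta> t) (\<lambda>b c. h (a * S d) (b * S c))))"
    by (rule sw_cong, rule sw_coassoc[symmetric], intro lin_intros)
  also have "\<dots> = sw (\<Delta> v) (\<lambda>a w. h (a * S w) 1)"
    by (rule sw_cong, rule sw_antipode_right1[where f = "\<lambda>y d. h (_ * S d) y"], intro lin_intros)
  also have "\<dots> = \<epsilon> v \<bullet> h 1 1"
    by (rule sw_antipode_right, intro lin_intros)
  finally show ?thesis .
qed

text \<open>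
  Convolution inverses of \<open>\<Delta>\<close> are unique, and \<open>x \<mapsto> \<Delta>(S(x))\<close> is a left one.
\<close>

lemma sw_comul_antipode:
  assumes f: "bilin f"
  shows "sw (\<Delta> (S x)) f = sw (\<Delta> x) (\<lambda>u v. f (S v) (S u))"
proof -
  note [lin_intros] = lin_bilin1[OF f] lin_bilin2[OF f]
  have "sw (\<Delta> (S x)) f = sw (\<Delta> x) (\<lambda>u v. \<epsilon> v \<bullet> sw (\<Delta> (S u)) f)"
    by (rule sw_counit_right[symmetric], intro lin_intros f)
  also have "\<dots> = sw (\<Delta> x) (\<lambda>u v. sw (\<Delta> v) (\<lambda>p q. sw (\<Delta> p) (\<lambda>a b. sw (\<Delta> q) (\<lambda>c d.
      sw (\<Delta> (S u)) (\<lambda>e1 e2. f (e1 * (a * S d)) (e2 * (b * S c)))))))"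
    by (subst sw_comul_antipode_inverse[where h = "\<lambda>m n. sw (\<Delta> (S _)) (\<lambda>e1 e2. f (e1 * m) (e2 * n))"])
      (intro lin_intros, simp)
  also have "\<dots> = sw (\<Delta> x) (\<lambda>r q. sw (\<Delta> r) (\<lambda>u p. sw (\<Delta> p) (\<lambda>a b. sw (\<Delta> q) (\<lambda>c d.
      sw (\<Delta> (S u)) (\<lambda>e1 e2. f (e1 * (a * S d)) (e2 * (b * S c)))))))"
    by (rule sw_coassoc[symmetric], intro lin_intros)
  also have "\<dots> = sw (\<Delta> x) (\<lambda>r q. sw (\<Delta> r) (\<lambda>u p. sw (\<Delta> (S u * p)) (\<lambda>a b. sw (\<Delta> q) (\<lambda>c d.
      f (a * S d) (b * S c)))))"
    by (subst sw_comul_mult, intro lin_intros, subst sw_swap[of "\<Delta> (S _)"], subst sw_swap[of "\<Delta> (S _)"])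
      (simp add: mult.assoc)
  also have "\<dots> = sw (\<Delta> x) (\<lambda>r q. \<epsilon> r \<bullet> sw (\<Delta> 1) (\<lambda>a b. sw (\<Delta> q) (\<lambda>c d.
      f (a * S d) (b * S c))))"
    by (rule sw_cong, rule sw_antipode_left[where l = "\<lambda>x. sw (\<Delta> x) _"], intro lin_intros)
  also have "\<dots> = sw (\<Delta> x) (\<lambda>r q. \<epsilon> r \<bullet> sw (\<Delta> q) (\<lambda>c d. f (S d) (S c)))"
    by (subst sw_comul_one, intro lin_intros, simp)
  also have "\<dots> = sw (\<Delta> x) (\<lambda>c d. f (S d) (S c))"
    by (rule sw_counit_left, intro lin_intros)
  finally show ?thesis .
qed

end

section \<open>Right integrals are nondegenerate\<close>

lemma (in hopf_algebra) functionalI: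
  "(\<And>x y. f (x + y) = f x + f y) \<Longrightarrow> (\<And>c x. f (c \<bullet> x) = c * f x) \<Longrightarrow> functional f"
  using vector_space
  by (auto simp: functional_def Vector_Spaces.linear_def module_hom_def module_hom_axioms_def
      vector_space_def module_def algebra_simps)

context finite_dimensional_hopf_algebra
begin

text \<open>
  Finite dimension enters through this coordinate system and through
  \<open>injective_imp_surjective\<close> alone.
\<close>

lemma dual_basis:
  "\<exists>B e. finite B \<and> (\<forall>i. functional (e i)) \<and> (\<forall>x. (\<Sum>i\<in>B. e i x \<bullet> i) = x) \<and>
    (\<forall>i. \<forall>j\<in>B. e i j = (if i = j then 1 else 0))"
proof -
  obtain B where "finite_dimensional_vector_space (smul H) B"
    using finite_dimensional by blast
  then interpret F: finite_dimensional_vector_space "smul H" B .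
  define e where "e i x = V.representation B x i" for i x
  have "functional (e i)" for i
    by (rule functionalI)
      (simp_all add: e_def V.representation_add V.representation_scale F.independent_Basis F.span_Basis)
  moreover have "(\<Sum>i\<in>B. e i x \<bullet> i) = x" for x
    unfolding e_def
    by (rule V.sum_representation_eq[OF F.independent_Basis _ F.finite_Basis])
      (simp_all add: F.span_Basis)
  moreover have "e i j = (if i = j then 1 else 0)" if "j \<in> B" for i j
    using V.representation_basis[OF F.independent_Basis that] by (simp add: e_def)
  ultimately show ?thesis
    using F.finite_Basis by blast
qed

lemma injective_imp_surjective:
  assumes "lin l" "\<And>x. l x = 0 \<Longrightarrow> x = 0"
  shows "surj l"
proof -
  obtain B where "finite_dimensional_vector_space (smul H) B"
    using finite_dimensional by blast
  then interpret F: finite_dimensional_vector_space "smul H" B .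
  interpret L: Vector_Spaces.linear "smul H" "smul H" l
    using assms(1) by (simp add: lin_linear)
  show ?thesis
    using F.linear_inj_imp_surj[OF L.linear_axioms] assms(2) by (simp add: L.inj_iff_eq_0)
qed

end

locale hopf_right_integral = finite_dimensional_hopf_algebra H
  for H :: "('k::field, 'a::ring_1) hopf" +
  fixes \<phi> :: "'a \<Rightarrow> 'k"
  assumes right_integral: "right_integral_dual H \<phi>"
    and nonzero: "\<phi> \<noteq> (\<lambda>_. 0)"
begin

lemma functional_integral: "functional \<phi>"
  using right_integral by (simp add: right_integral_dual_def functional_def)

lemmas lin_integral [lin_intros] = lin_functional[OF functional_integral]

lemma sw_integral: "lin l \<Longrightarrow> sw (\<Delta> b) (\<lambda>u v. \<phi> u \<bullet> l v) = \<phi> b \<bullet> l 1"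
  using right_integral sw_lin[of l "\<Delta> b" "\<lambda>u v. \<phi> u \<bullet> v"]
  by (simp add: right_integral_dual_def sw_def lin_def)

lemma integral_comul_mult:
  "lin l \<Longrightarrow> sw (\<Delta> a) (\<lambda>a1 a2. sw (\<Delta> b) (\<lambda>b1 b2. \<phi> (a1 * b1) \<bullet> l (a2 * b2))) = \<phi> (a * b) \<bullet> l 1"
  by (subst sw_comul_mult[symmetric, where f = "\<lambda>x y. \<phi> x \<bullet> l y"])
    (intro lin_intros, erule lin_comp, rule lin_id, rule sw_integral)

text \<open>
  The integral property of \<open>\<phi>\<close> applied to \<open>S(a\<^sub>2) b\<close>, whose coproduct is
  \<open>S(a\<^sub>3) b\<^sub>1 \<otimes> S(a\<^sub>2) b\<^sub>2\<close>; multiplication by \<open>a\<^sub>1\<close> on the left then cancels \<open>S(a\<^sub>2)\<close>. In the language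
  of Hopf modules: the functionals \<open>b \<mapsto> \<phi>(S(a) b)\<close> are the \<open>A\<close>-orbit of \<open>\<phi>\<close>, and \<open>A\<close> coacts on
  them through the coproduct of \<open>a\<close>.
\<close>

lemma integral_antipode_comul:
  "sw (\<Delta> b) (\<lambda>u v. \<phi> (S a * u) \<bullet> v) = sw (\<Delta> a) (\<lambda>p q. \<phi> (S q * b) \<bullet> p)"
proof -
  have "sw (\<Delta> a) (\<lambda>p q. \<phi> (S q * b) \<bullet> p)
      = sw (\<Delta> a) (\<lambda>p q. sw (\<Delta> (S q)) (\<lambda>s t. sw (\<Delta> b) (\<lambda>u v. \<phi> (s * u) \<bullet> (p * (t * v)))))"
    by (subst integral_comul_mult, intro lin_intros, simp)
  also have "\<dots> = sw (\<Delta> a) (\<lambda>p q. sw (\<Delta> q) (\<lambda>t s. sw (\<Delta> b) (\<lambda>u v. \<phi> (S s * u) \<bullet> (p * (S t * v)))))"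
    by (subst sw_comul_antipode, intro lin_intros, rule refl)
  also have "\<dots> = sw (\<Delta> a) (\<lambda>r s. sw (\<Delta> r) (\<lambda>p t. sw (\<Delta> b) (\<lambda>u v. \<phi> (S s * u) \<bullet> ((p * S t) * v))))"
    by (subst mult.assoc, rule sw_coassoc[symmetric], intro lin_intros)
  also have "\<dots> = sw (\<Delta> b) (\<lambda>u v. \<phi> (S a * u) \<bullet> (1 * v))"
    by (rule sw_antipode_right1[where f = "\<lambda>a s. sw (\<Delta> b) (\<lambda>u v. \<phi> (S s * u) \<bullet> (a * v))"], intro lin_intros)
  finally show ?thesis by simp
qed

text \<open>
  This is the injectivity half of the fundamental theorem of Hopf modules, for the dual of \<open>A\<close>.
  From \<open>\<phi>(S(a) b) = 0\<close> for all \<open>b\<close> the preceding identity gives \<open>\<phi>(S(a\<^sub>2) b) a\<^sub>1 = 0\<close> for all \<open>b\<close>.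
  On the other hand \<open>\<phi>(b) a = \<phi>(S(S(a\<^sub>2) a\<^sub>3) b) a\<^sub>1 = \<phi>(S(a\<^sub>3) S\<^sup>2(a\<^sub>2) b) a\<^sub>1\<close>. Here the argument
  \<open>S\<^sup>2(a\<^sub>2) b\<close> depends on \<open>a\<close>; expanding \<open>a\<^sub>2\<close> in a basis makes it independent, and every summand
  vanishes.
\<close>

lemma integral_antipode_nondegenerate:
  assumes "\<And>b. \<phi> (S a * b) = 0"
  shows "a = 0"
proof -
  obtain B e where B: "finite B" and "\<forall>i. functional (e i)"
    and "\<forall>x. (\<Sum>i\<in>B. e i x \<bullet> i) = x"
    using dual_basis by blast
  then have e: "functional (e i)" and expand: "(\<Sum>i\<in>B. e i x \<bullet> i) = x" for i x
    by blast+
  note [lin_intros] = lin_functional[OF e]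
  have zero: "sw (\<Delta> a) (\<lambda>r q. \<phi> (S q * b) \<bullet> r) = 0" for b
    unfolding integral_antipode_comul[symmetric] by (simp add: assms sw_def tensor_sum_def lin_ext_def)
  \<comment> \<open>any \<open>b\<close> with \<open>\<phi>(b) \<noteq> 0\<close> will do: it is the scalar by which \<open>a\<close> is recovered\<close>
  obtain b where b: "\<phi> b \<noteq> 0"
    using nonzero by auto
  have "\<phi> b \<bullet> a = sw (\<Delta> a) (\<lambda>p q. sw (\<Delta> q) (\<lambda>s t. \<phi> (S (S s * t) * b) \<bullet> p))"
    by (subst sw_antipode_left2[where f = "\<lambda>p q. \<phi> (S q * b) \<bullet> p"]) (intro lin_intros, simp add: antipode_one)
  also have "\<dots> = sw (\<Delta> a) (\<lambda>p q. sw (\<Delta> q) (\<lambda>s t. \<phi> (S t * (S (S s) * b)) \<bullet> p))"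
    by (simp add: antipode_mult mult.assoc)
  also have "\<dots> = sw (\<Delta> a) (\<lambda>r t. sw (\<Delta> r) (\<lambda>p s. \<phi> (S t * (S (S s) * b)) \<bullet> p))"
    by (rule sw_coassoc[symmetric], intro lin_intros)
  also have "\<dots> = sw (\<Delta> a) (\<lambda>r t. sw (\<Delta> r) (\<lambda>p s. \<Sum>i\<in>B. e i s \<bullet> (\<phi> (S t * (S (S i) * b)) \<bullet> p)))"
  proof (intro sw_cong)
    fix t p s
    have l: "lin (\<lambda>s. \<phi> (S t * (S (S s) * b)) \<bullet> p)"
      by (intro lin_intros)
    then interpret L: Vector_Spaces.linear "smul H" "smul H" "\<lambda>s. \<phi> (S t * (S (S s) * b)) \<bullet> p"
      by (simp add: lin_linear)
    show "\<phi> (S t * (S (S s) * b)) \<bullet> p = (\<Sum>i\<in>B. e i s \<bullet> (\<phi> (S t * (S (S i) * b)) \<bullet> p))"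
      by (subst expand[of s, symmetric]) (simp only: L.sum L.scale)
  qed
  also have "\<dots> = (\<Sum>i\<in>B. sw (\<Delta> a) (\<lambda>r t. sw (\<Delta> r) (\<lambda>p s. e i s \<bullet> (\<phi> (S t * (S (S i) * b)) \<bullet> p))))"
    by (simp add: sw_sum[OF B])
  also have "\<dots> = (\<Sum>i\<in>B. sw (\<Delta> (sw (\<Delta> a) (\<lambda>r t. \<phi> (S t * (S (S i) * b)) \<bullet> r))) (\<lambda>p s. e i s \<bullet> p))"
    by (subst sw_comul_sw, intro lin_intros, subst lin_scale[where l = "\<lambda>x. sw (\<Delta> x) _"], intro lin_intros)
      (simp add: sw_scale[symmetric] mult.commute)
  also have "\<dots> = 0"
    unfolding zero by (subst lin_0[where l = "\<lambda>x. sw (\<Delta> x) _"], intro lin_intros, simp)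
  finally show ?thesis
    using b by simp
qed

lemma antipode_eq_0: "S a = 0 \<Longrightarrow> a = 0"
  by (rule integral_antipode_nondegenerate) (simp add: functional_0[OF functional_integral])

lemma antipode_inj: "S a = S b \<Longrightarrow> a = b"
proof -
  assume "S a = S b"
  moreover have "S (a - b) = S a - S b"
  proof -
    interpret Vector_Spaces.linear "smul H" "smul H" S by (rule linear_antipode)
    show ?thesis by (rule diff)
  qed
  ultimately show "a = b"
    using antipode_eq_0[of "a - b"] by simp
qed

lemma antipode_surj: "surj S"
  by (rule injective_imp_surjective) (use lin_antipode[OF lin_id] antipode_eq_0 in auto)

lemma integral_nondegenerate:
  assumes "\<And>b. \<phi> (x * b) = 0"
  shows "x = 0"
proof -
  obtain a where "x = S a"
    using antipode_surj by blast
  with assms have "a = 0"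
    by (blast intro: integral_antipode_nondegenerate)
  with \<open>x = S a\<close> show ?thesis
    by (simp add: lin_0[OF lin_antipode[OF lin_id]])
qed

text \<open>
  The map \<open>x \<mapsto> \<phi>(x -)\<close> from \<open>A\<close> to its dual is injective, hence onto. To stay inside \<open>A\<close>, the
  dual is identified with \<open>A\<close> by sending a functional to the combination of basis vectors with
  its values as coefficients.
\<close>

lemma functional_eq_hit_integral:
  assumes f: "functional f"
  obtains x where "\<And>b. f b = \<phi> (x * b)"
proof -
  obtain B e where B: "finite B" and "\<forall>i. functional (e i)"
    and "\<forall>x. (\<Sum>i\<in>B. e i x \<bullet> i) = x"
    and dual: "\<forall>i. \<forall>j\<in>B. e i j = (if i = j then 1 else 0)"
    using dual_basis by blast
  then have e: "functional (e i)" and expand: "(\<Sum>i\<in>B. e i x \<bullet> i) = x" for i x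
    by blast+
  have ext: "g = g'" if "functional g" "functional g'" "\<And>i. i \<in> B \<Longrightarrow> g i = g' i" for g g'
  proof
    fix x
    have eq: "g x = (\<Sum>i\<in>B. e i x * g i)" if "functional g" for g
      using arg_cong[OF expand[of x], of g, symmetric] by (simp only: functional_sum[OF that] functional_scale[OF that])
    show "g x = g' x"
      using that by (simp add: eq)
  qed
  \<comment> \<open>\<open>x \<mapsto> \<phi>(x -)\<close>, with the dual of \<open>A\<close> identified with \<open>A\<close>\<close>
  define T where "T x = (\<Sum>i\<in>B. \<phi> (x * i) \<bullet> i)" for x
  have T: "lin T"
    by (auto simp: T_def lin_def distrib_right smul_mult_left functional_add[OF functional_integral]
        functional_scale[OF functional_integral] V.scale_left_distrib sum.distrib V.scale_sum_right)
  have hit: "functional (\<lambda>b. \<phi> (x * b))" for x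
    by (rule functionalI) (simp_all add: distrib_left smul_mult_right
        functional_add[OF functional_integral] functional_scale[OF functional_integral])
  have coord: "e i (\<Sum>j\<in>B. c j \<bullet> j) = c i" if "i \<in> B" for i c
  proof -
    have "e i (\<Sum>j\<in>B. c j \<bullet> j) = (\<Sum>j\<in>B. c j * e i j)"
      by (simp only: functional_sum[OF e] functional_scale[OF e])
    also have "\<dots> = (\<Sum>j\<in>B. if i = j then c j else 0)"
      by (intro sum.cong refl) (simp add: dual)
    also have "\<dots> = c i"
      using that B by simp
    finally show ?thesis .
  qed
  have "surj T"
  proof (rule injective_imp_surjective[OF T])
    fix x assume "T x = 0"
    then have "\<phi> (x * i) = 0" if "i \<in> B" for i
      using coord[OF that, of "\<lambda>i. \<phi> (x * i)"] functional_0[OF e] by (simp add: T_def)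
    then have "(\<lambda>b. \<phi> (x * b)) = (\<lambda>b. 0)"
      by (intro ext[OF hit] functionalI) simp_all
    then show "x = 0"
      by (intro integral_nondegenerate) (simp add: fun_eq_iff)
  qed
  then obtain x where x: "T x = (\<Sum>i\<in>B. f i \<bullet> i)"
    using \<open>surj T\<close> unfolding surj_def by metis
  have "f = (\<lambda>b. \<phi> (x * b))"
  proof (rule ext[OF f hit])
    fix i assume "i \<in> B"
    show "f i = \<phi> (x * i)"
      using coord[OF \<open>i \<in> B\<close>, of f] coord[OF \<open>i \<in> B\<close>, of "\<lambda>i. \<phi> (x * i)"] x
      by (simp add: T_def)
  qed
  then show thesis
    by (intro that) (simp add: fun_eq_iff)
qed

text \<open>
  The integral property for the product \<open>b a\<^sub>1\<close>, followed by cancellation of \<open>a\<^sub>2 S(a\<^sub>3)\<close>.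
\<close>

lemma sw_integral_right:
  "sw (\<Delta> b) (\<lambda>u v. \<phi> (u * a) \<bullet> v) = sw (\<Delta> a) (\<lambda>p q. \<phi> (b * p) \<bullet> S q)"
proof -
  have "sw (\<Delta> a) (\<lambda>p q. \<phi> (b * p) \<bullet> S q)
      = sw (\<Delta> a) (\<lambda>p q. sw (\<Delta> b) (\<lambda>u v. sw (\<Delta> p) (\<lambda>s t. \<phi> (u * s) \<bullet> ((v * t) * S q))))"
    by (subst integral_comul_mult, intro lin_intros, simp)
  also have "\<dots> = sw (\<Delta> b) (\<lambda>u v. sw (\<Delta> a) (\<lambda>p q. sw (\<Delta> p) (\<lambda>s t. \<phi> (u * s) \<bullet> (v * (t * S q)))))"
    by (subst sw_swap) (simp add: mult.assoc)
  also have "\<dots> = sw (\<Delta> b) (\<lambda>u v. sw (\<Delta> a) (\<lambda>s w. sw (\<Delta> w) (\<lambda>t q. \<phi> (u * s) \<bullet> (v * (t * S q)))))"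
    by (rule sw_cong, rule sw_coassoc, intro lin_intros)
  also have "\<dots> = sw (\<Delta> b) (\<lambda>u v. \<phi> (u * a) \<bullet> (v * 1))"
    by (rule sw_cong, rule sw_antipode_right2[where f = "\<lambda>s w. \<phi> (_ * s) \<bullet> (_ * w)"], intro lin_intros)
  finally show ?thesis by simp
qed

text \<open>
  The mirror image of the preceding lemma. Moving \<open>a\<close> across the coproduct of \<open>b\<close> would
  introduce \<open>S\<^sup>-\<^sup>1(a\<^sub>2)\<close>; keeping \<open>S(b\<^sub>2)\<close> on the other side avoids the inverse of the antipode.
\<close>

lemma sw_integral_left:
  assumes l: "lin l"
  shows "sw (\<Delta> b) (\<lambda>u v. \<phi> (a * u) \<bullet> l (S v)) = sw (\<Delta> a) (\<lambda>p q. \<phi> (p * b) \<bullet> l q)"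
proof -
  note [lin_intros] = lin_comp[OF l]
  have "sw (\<Delta> b) (\<lambda>u v. \<phi> (a * u) \<bullet> l (S v))
      = sw (\<Delta> b) (\<lambda>u v. sw (\<Delta> a) (\<lambda>p q. sw (\<Delta> u) (\<lambda>s t. \<phi> (p * s) \<bullet> l ((q * t) * S v))))"
    by (subst integral_comul_mult[where l = "\<lambda>x. l (x * S _)"], intro lin_intros, simp)
  also have "\<dots> = sw (\<Delta> a) (\<lambda>p q. sw (\<Delta> b) (\<lambda>u v. sw (\<Delta> u) (\<lambda>s t. \<phi> (p * s) \<bullet> l (q * (t * S v)))))"
    by (subst sw_swap) (simp add: mult.assoc)
  also have "\<dots> = sw (\<Delta> a) (\<lambda>p q. sw (\<Delta> b) (\<lambda>s w. sw (\<Delta> w) (\<lambda>t v. \<phi> (p * s) \<bullet> l (q * (t * S v)))))"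
    by (rule sw_cong, rule sw_coassoc, intro lin_intros)
  also have "\<dots> = sw (\<Delta> a) (\<lambda>p q. \<phi> (p * b) \<bullet> l (q * 1))"
    by (rule sw_cong, rule sw_antipode_right2[where f = "\<lambda>s w. \<phi> (_ * s) \<bullet> l (_ * w)"], intro lin_intros)
  finally show ?thesis by simp
qed

end

section \<open>The Nakayama automorphism of a right integral\<close>

context hopf_algebra
begin

text \<open>
  The sum \<open>S(x\<^sub>1) x\<^sub>2 \<otimes> x\<^sub>3\<close> with the coproduct nested in the second factor instead of the first.
\<close>

lemma sw_antipode_left3:
  assumes f: "bilin f"
  shows "sw (\<Delta> x) (\<lambda>u v. sw (\<Delta> v) (\<lambda>a b. f (S u * a) b)) = f 1 x"
proof -
  note [lin_intros] = lin_bilin1[OF f] lin_bilin2[OF f]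
  have "sw (\<Delta> x) (\<lambda>u v. sw (\<Delta> v) (\<lambda>a b. f (S u * a) b)) = sw (\<Delta> x) (\<lambda>u v. sw (\<Delta> u) (\<lambda>a b. f (S a * b) v))"
    by (rule sw_coassoc[symmetric], intro lin_intros)
  also have "\<dots> = f 1 x"
    by (rule sw_antipode_left1[OF f])
  finally show ?thesis .
qed

end

locale hopf_distinguished = hopf_right_integral H \<phi>
  for H :: "('k::field, 'a::ring_1) hopf" and \<phi> +
  fixes \<alpha> :: "'a \<Rightarrow> 'k"
  assumes distinguished: "distinguished_grouplike H \<alpha>"
begin

lemma distinguished_algebra_map: "algebra_map H \<alpha>"
  by (rule distinguished_grouplike_algebra_map[OF hopf_algebra_axioms distinguished])

lemma functional_distinguished: "functional \<alpha>"
  using distinguished_algebra_map by (simp add: algebra_map_def functional_def)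

lemma distinguished_mult: "\<alpha> (x * y) = \<alpha> x * \<alpha> y"
  and distinguished_one: "\<alpha> 1 = 1"
  using distinguished_algebra_map by (simp_all add: algebra_map_def)

lemmas lin_distinguished [lin_intros] = lin_functional[OF functional_distinguished]

definition nakayama :: "'a \<Rightarrow> 'a"
  where "nakayama y = sw (\<Delta> y) (\<lambda>p q. \<alpha> p \<bullet> S (S q))"

lemma lin_nakayama [lin_intros]: "lin h \<Longrightarrow> lin (\<lambda>x. nakayama (h x))"
  unfolding nakayama_def by (intro lin_intros)

lemma sw_distinguished_antipode:
  "lin l \<Longrightarrow> sw (\<Delta> y) (\<lambda>p q. \<alpha> p \<bullet> l (S (S q))) = l (nakayama y)"
  unfolding nakayama_def by (simp add: sw_lin lin_scale)

lemma nakayama_one: "nakayama 1 = 1"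
  unfolding nakayama_def by (subst sw_comul_one, intro lin_intros) (simp add: antipode_one distinguished_one)

text \<open>
  The Nakayama map is multiplicative since \<open>\<Delta>\<close>, \<open>\<alpha>\<close> and \<open>S\<^sup>2\<close> are.
\<close>

lemma nakayama_mult: "nakayama (x * y) = nakayama x * nakayama y"
proof -
  have "nakayama (x * y) = sw (\<Delta> x) (\<lambda>a b. sw (\<Delta> y) (\<lambda>c d. \<alpha> (a * c) \<bullet> S (S (b * d))))"
    unfolding nakayama_def by (subst sw_comul_mult, intro lin_intros) (rule refl)
  also have "\<dots> = nakayama x * nakayama y"
    unfolding nakayama_def sw_mult_left sw_mult_right
    by (subst sw_swap)
      (simp add: antipode_mult distinguished_mult smul_mult_left smul_mult_right mult.commute)
  finally show ?thesis .
qed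

lemma sw_comul_nakayama:
  assumes f: "bilin f"
  shows "sw (\<Delta> (nakayama y)) f = sw (\<Delta> y) (\<lambda>p q. f (nakayama p) (S (S q)))"
proof -
  note [lin_intros] = lin_bilin1[OF f] lin_bilin2[OF f]
  have "sw (\<Delta> (nakayama y)) f = sw (\<Delta> y) (\<lambda>p q. sw (\<Delta> (\<alpha> p \<bullet> S (S q))) f)"
    unfolding nakayama_def by (rule sw_comul_sw[OF f])
  also have "\<dots> = sw (\<Delta> y) (\<lambda>p q. \<alpha> p \<bullet> sw (\<Delta> (S (S q))) f)"
    by (intro sw_cong, rule lin_scale[where l = "\<lambda>x. sw (\<Delta> x) f"], rule lin_sw_comul[OF lin_id f])
  also have "\<dots> = sw (\<Delta> y) (\<lambda>p q. \<alpha> p \<bullet> sw (\<Delta> q) (\<lambda>a b. f (S (S a)) (S (S b))))"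
    by (subst sw_comul_antipode, rule f, subst sw_comul_antipode, intro lin_intros, rule refl)
  also have "\<dots> = sw (\<Delta> y) (\<lambda>p q. sw (\<Delta> q) (\<lambda>a b. \<alpha> p \<bullet> f (S (S a)) (S (S b))))"
    by (simp add: sw_scale)
  also have "\<dots> = sw (\<Delta> y) (\<lambda>u v. sw (\<Delta> u) (\<lambda>p a. \<alpha> p \<bullet> f (S (S a)) (S (S v))))"
    by (rule sw_coassoc[symmetric], intro lin_intros)
  also have "\<dots> = sw (\<Delta> y) (\<lambda>u v. f (nakayama u) (S (S v)))"
    by (rule sw_cong, rule sw_distinguished_antipode[where l = "\<lambda>x. f x _"], intro lin_intros)
  finally show ?thesis .
qed

text \<open>
  Let \<open>\<Lambda>\<close> be a left integral. Because \<open>\<phi>(b \<Lambda>\<^sub>1) S(\<Lambda>\<^sub>2) = \<phi>(\<Lambda>) b\<close>, a functional \<open>\<phi>(z -)\<close> is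
  determined by the element \<open>\<phi>(z \<Lambda>\<^sub>1) S(\<Lambda>\<^sub>2)\<close>. The two functionals \<open>x \<mapsto> \<phi>(x y)\<close> and
  \<open>x \<mapsto> \<phi>(\<nu>(y) x)\<close> therefore agree as soon as they agree on \<open>\<Lambda>\<^sub>1\<close>, and there
  \<open>\<Lambda>\<^sub>1 y \<otimes> \<Lambda>\<^sub>2 = \<alpha>(y\<^sub>1) \<Lambda>\<^sub>1 \<otimes> \<Lambda>\<^sub>2 S(y\<^sub>2)\<close> turns both into \<open>\<phi>(\<Lambda>) \<nu>(y)\<close>.
\<close>

lemma integral_mult_commute: "\<phi> (x * y) = \<phi> (nakayama y * x)"
proof -
  obtain L where L: "L \<noteq> 0" "\<And>a. a * L = \<epsilon> a \<bullet> L" "\<And>a. L * a = \<alpha> a \<bullet> L"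
    using distinguished by (auto simp: distinguished_grouplike_def left_integral_def)
  \<comment> \<open>every functional is \<open>\<phi>(x -)\<close>, and \<open>\<phi>(x \<Lambda>) = \<epsilon>(x) \<phi>(\<Lambda>)\<close>; if \<open>\<phi>(\<Lambda>) = 0\<close>, all functionals
    kill \<open>\<Lambda>\<close>\<close>
  have "\<phi> L \<noteq> 0"
  proof
    assume zero: "\<phi> L = 0"
    obtain B e where "finite B" "\<forall>i. functional (e i)" "\<forall>x. (\<Sum>i\<in>B. e i x \<bullet> i) = x"
      using dual_basis by blast
    moreover have "e i L = 0" if "functional (e i)" for i
    proof -
      obtain x where "\<And>b. e i b = \<phi> (x * b)"
        using functional_eq_hit_integral \<open>functional (e i)\<close> by blast
      then show ?thesis
        by (simp add: L functional_scale[OF functional_integral] zero)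
    qed
    ultimately have "L = (\<Sum>i\<in>B. 0)"
      by (metis (no_types, lifting) V.scale_zero_left sum.cong)
    with L show False by simp
  qed
  \<comment> \<open>the two legs of \<open>\<Lambda>\<close> are dual bases for \<open>\<phi>\<close>\<close>
  have rep: "sw (\<Delta> L) (\<lambda>u v. \<phi> (b * u) \<bullet> S v) = \<phi> L \<bullet> b" for b
  proof -
    have "sw (\<Delta> L) (\<lambda>u v. \<phi> (b * u) \<bullet> S v) = sw (\<Delta> b) (\<lambda>u v. \<phi> (\<epsilon> u \<bullet> L) \<bullet> v)"
      unfolding sw_integral_right[symmetric] L ..
    also have "\<dots> = sw (\<Delta> b) (\<lambda>u v. \<epsilon> u \<bullet> (\<phi> L \<bullet> v))"
      by (simp add: functional_scale[OF functional_integral])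
    also have "\<dots> = \<phi> L \<bullet> b"
      by (rule sw_counit_left, intro lin_intros)
    finally show ?thesis .
  qed
  \<comment> \<open>from \<open>\<Lambda> y\<^sub>1 = \<alpha>(y\<^sub>1) \<Lambda>\<close>, with \<open>S(y\<^sub>2)\<close> cancelling the coproduct of \<open>y\<^sub>1\<close> in the second leg\<close>
  have move: "sw (\<Delta> L) (\<lambda>u v. f (u * y) v) = sw (\<Delta> y) (\<lambda>p q. \<alpha> p \<bullet> sw (\<Delta> L) (\<lambda>u v. f u (v * S q)))"
    if f: "bilin f" for f y
  proof -
    note [lin_intros] = lin_bilin1[OF f] lin_bilin2[OF f]
    have "sw (\<Delta> y) (\<lambda>p q. \<alpha> p \<bullet> sw (\<Delta> L) (\<lambda>u v. f u (v * S q)))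
        = sw (\<Delta> y) (\<lambda>p q. sw (\<Delta> (L * p)) (\<lambda>u v. f u (v * S q)))"
      unfolding L by (intro sw_cong, rule lin_scale[where l = "\<lambda>x. sw (\<Delta> x) _", symmetric], intro lin_intros)
    also have "\<dots> = sw (\<Delta> L) (\<lambda>u v. sw (\<Delta> y) (\<lambda>p q. sw (\<Delta> p) (\<lambda>a b. f (u * a) (v * (b * S q)))))"
      by (subst sw_comul_mult, intro lin_intros, subst sw_swap) (simp add: mult.assoc)
    also have "\<dots> = sw (\<Delta> L) (\<lambda>u v. sw (\<Delta> y) (\<lambda>a w. sw (\<Delta> w) (\<lambda>b q. f (u * a) (v * (b * S q)))))"
      by (rule sw_cong, rule sw_coassoc, intro lin_intros)
    also have "\<dots> = sw (\<Delta> L) (\<lambda>u v. f (u * y) (v * 1))"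
      by (rule sw_cong, rule sw_antipode_right2[where f = "\<lambda>a b. f (_ * a) (_ * b)"], intro lin_intros)
    finally show ?thesis by simp
  qed
  define f where "f x = \<phi> (x * y) - \<phi> (nakayama y * x)" for x
  have f: "functional f"
    by (rule functionalI)
      (simp_all add: f_def distrib_left distrib_right functional_add[OF functional_integral]
        functional_scale[OF functional_integral] smul_mult_left smul_mult_right algebra_simps)
  have "sw (\<Delta> L) (\<lambda>u v. \<phi> (u * y) \<bullet> S v)
      = sw (\<Delta> y) (\<lambda>p q. \<alpha> p \<bullet> sw (\<Delta> L) (\<lambda>u v. \<phi> u \<bullet> S (v * S q)))"
    by (rule move, intro lin_intros)
  also have "\<dots> = sw (\<Delta> y) (\<lambda>p q. \<alpha> p \<bullet> (S (S q) * sw (\<Delta> L) (\<lambda>u v. \<phi> u \<bullet> S v)))"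
    by (simp add: sw_mult_right antipode_mult smul_mult_right)
  also have "\<dots> = sw (\<Delta> y) (\<lambda>p q. \<phi> L \<bullet> (\<alpha> p \<bullet> S (S q)))"
    using rep[of 1] by (simp add: smul_mult_right mult.commute)
  also have "\<dots> = sw (\<Delta> L) (\<lambda>u v. \<phi> (nakayama y * u) \<bullet> S v)"
    unfolding rep sw_scale nakayama_def ..
  finally have zero: "sw (\<Delta> L) (\<lambda>u v. f u \<bullet> S v) = 0"
    by (simp add: f_def V.scale_left_diff_distrib sw_def tensor_sum_def lin_ext_def
        case_prod_beta' V.scale_right_diff_distrib sum_subtractf)
  obtain z where z: "\<And>b. f b = \<phi> (z * b)"
    using functional_eq_hit_integral[OF f] by blast
  have "\<phi> L \<bullet> z = 0"
    using zero unfolding z rep .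
  with \<open>\<phi> L \<noteq> 0\<close> have "z = 0" by simp
  then have "f x = 0"
    by (simp add: z functional_0[OF functional_integral])
  then show ?thesis
    by (simp add: f_def)
qed

end

section \<open>Twists\<close>

context hopf_algebra
begin

text \<open>
  Right multiplication by \<open>X \<otimes> 1\<close>, \<open>1 \<otimes> X\<close>, \<open>(\<Delta> \<otimes> id)(X)\<close> and \<open>(id \<otimes> \<Delta>)(X)\<close> on \<open>A \<otimes> A \<otimes> A\<close>,
  transposed to trilinear maps. Composition of these operators is multiplication of the
  tensors, in the same order, so equations in \<open>A \<otimes> A \<otimes> A\<close> can be inverted by composing operators.
\<close>

definition rmult12 :: "('k, 'a) tensor2 \<Rightarrow> ('a \<Rightarrow> 'a \<Rightarrow> 'a \<Rightarrow> 'a) \<Rightarrow> 'a \<Rightarrow> 'a \<Rightarrow> 'a \<Rightarrow> 'a"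
  where "rmult12 X f = (\<lambda>a b c. sw X (\<lambda>x y. f (a * x) (b * y) c))"

definition rmult23 :: "('k, 'a) tensor2 \<Rightarrow> ('a \<Rightarrow> 'a \<Rightarrow> 'a \<Rightarrow> 'a) \<Rightarrow> 'a \<Rightarrow> 'a \<Rightarrow> 'a \<Rightarrow> 'a"
  where "rmult23 X f = (\<lambda>a b c. sw X (\<lambda>x y. f a (b * x) (c * y)))"

definition rmult_comul_left :: "('k, 'a) tensor2 \<Rightarrow> ('a \<Rightarrow> 'a \<Rightarrow> 'a \<Rightarrow> 'a) \<Rightarrow> 'a \<Rightarrow> 'a \<Rightarrow> 'a \<Rightarrow> 'a"
  where "rmult_comul_left X f = (\<lambda>a b c. sw X (\<lambda>x y. sw (\<Delta> x) (\<lambda>u v. f (a * u) (b * v) (c * y))))"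

definition rmult_comul_right :: "('k, 'a) tensor2 \<Rightarrow> ('a \<Rightarrow> 'a \<Rightarrow> 'a \<Rightarrow> 'a) \<Rightarrow> 'a \<Rightarrow> 'a \<Rightarrow> 'a \<Rightarrow> 'a"
  where "rmult_comul_right X f = (\<lambda>a b c. sw X (\<lambda>x y. sw (\<Delta> y) (\<lambda>u v. f (a * x) (b * u) (c * v))))"

lemma trilin_rmult:
  assumes "trilin f"
  shows "trilin (rmult12 X f)" "trilin (rmult23 X f)"
    "trilin (rmult_comul_left X f)" "trilin (rmult_comul_right X f)"
  unfolding rmult12_def rmult23_def rmult_comul_left_def rmult_comul_right_def
  by (intro lin_intros lin_trilin1[OF assms] lin_trilin2[OF assms] lin_trilin3[OF assms])+

end

locale hopf_twist = hopf_algebra H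
  for H :: "('k::field, 'a::ring_1) hopf" +
  fixes J :: "('k, 'a) tensor2"
  assumes twist: "normalized_twist H J"
begin

abbreviation "K \<equiv> twist_inv H J"

lemma twist_mult_inv: "mult2 (smul H) J K = pure2 (smul H) 1 1"
  and twist_inv_mult: "mult2 (smul H) K J = pure2 (smul H) 1 1"
proof -
  interpret T: monoid "tensor2_monoid (smul H)"
    by (rule monoid_tensor2)
  have "J \<in> Units (tensor2_monoid (smul H))"
    using twist by (simp add: normalized_twist_def)
  then show "mult2 (smul H) J K = pure2 (smul H) 1 1" "mult2 (smul H) K J = pure2 (smul H) 1 1"
    using T.Units_r_inv[of J] T.Units_l_inv[of J]
    by (simp_all add: twist_inv_def tensor2_monoid_def)
qed

lemma sw_twist_inv:
  assumes "bilin f"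
  shows "sw J (\<lambda>x y. sw K (\<lambda>v z. f (x * v) (y * z))) = f 1 1"
    and "sw K (\<lambda>v z. sw J (\<lambda>x y. f (v * x) (z * y))) = f 1 1"
  by (simp_all only: sw_mult2[OF assms, symmetric] twist_mult_inv twist_inv_mult sw_pure2[OF assms])

lemma sw_twist_counit:
  assumes "lin l"
  shows "sw J (\<lambda>x y. \<epsilon> x \<bullet> l y) = l 1" "sw J (\<lambda>x y. \<epsilon> y \<bullet> l x) = l 1"
    "sw K (\<lambda>x y. \<epsilon> x \<bullet> l y) = l 1" "sw K (\<lambda>x y. \<epsilon> y \<bullet> l x) = l 1"
proof -
  have 1: "sw J (\<lambda>x y. \<epsilon> x \<bullet> l y) = l 1" "sw J (\<lambda>x y. \<epsilon> y \<bullet> l x) = l 1" if "lin l" for l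
    using twist sw_lin[OF that, of J "\<lambda>x y. \<epsilon> x \<bullet> y"] sw_lin[OF that, of J "\<lambda>x y. \<epsilon> y \<bullet> x"]
    by (simp_all add: normalized_twist_def sw_def lin_scale[OF that])
  then show "sw J (\<lambda>x y. \<epsilon> x \<bullet> l y) = l 1" "sw J (\<lambda>x y. \<epsilon> y \<bullet> l x) = l 1"
    using assms by blast+
  note [lin_intros] = lin_comp[OF assms]
  have "l 1 = sw K (\<lambda>v z. sw J (\<lambda>x y. \<epsilon> (v * x) \<bullet> l (z * y)))"
    by (subst sw_twist_inv, intro lin_intros) (simp add: counit_one)
  also have "\<dots> = sw K (\<lambda>v z. \<epsilon> v \<bullet> sw J (\<lambda>x y. \<epsilon> x \<bullet> l (z * y)))"
    by (simp add: counit_mult sw_scale[symmetric])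
  also have "\<dots> = sw K (\<lambda>v z. \<epsilon> v \<bullet> l (z * 1))"
    by (subst 1, intro lin_intros) (rule refl)
  finally show "sw K (\<lambda>x y. \<epsilon> x \<bullet> l y) = l 1" by simp
  have "l 1 = sw K (\<lambda>v z. sw J (\<lambda>x y. \<epsilon> (z * y) \<bullet> l (v * x)))"
    by (subst sw_twist_inv(2)[where f = "\<lambda>x y. \<epsilon> y \<bullet> l x"], intro lin_intros) (simp add: counit_one)
  also have "\<dots> = sw K (\<lambda>v z. \<epsilon> z \<bullet> sw J (\<lambda>x y. \<epsilon> y \<bullet> l (v * x)))"
    by (simp add: counit_mult sw_scale[symmetric])
  also have "\<dots> = sw K (\<lambda>v z. \<epsilon> z \<bullet> l (v * 1))"
    by (subst 1(2), intro lin_intros) (rule refl)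
  finally show "sw K (\<lambda>x y. \<epsilon> y \<bullet> l x) = l 1" by simp
qed

lemma sw_twist_cocycle:
  assumes f: "trilin f"
  shows "sw J (\<lambda>x y. sw (\<Delta> x) (\<lambda>u v. sw J (\<lambda>X Y. f (u * X) (v * Y) y)))
       = sw J (\<lambda>x y. sw (\<Delta> y) (\<lambda>u v. sw J (\<lambda>X Y. f x (u * X) (v * Y))))"
proof -
  note [lin_intros] = lin_trilin1[OF f] lin_trilin2[OF f] lin_trilin3[OF f]
  have "ev3 (mult3 (smul H) (comul_left H J) (tensor_one_right H J)) f
      = ev3 (mult3 (smul H) (comul_right H J) (tensor_one_left H J)) f"
    using twist by (simp add: normalized_twist_def)
  then have "ev3 (comul_left H J) (\<lambda>a b c. ev3 (tensor_one_right H J) (\<lambda>a' b' c'. f (a * a') (b * b') (c * c')))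
      = ev3 (comul_right H J) (\<lambda>a b c. ev3 (tensor_one_left H J) (\<lambda>a' b' c'. f (a * a') (b * b') (c * c')))"
    by (simp only: ev3_mult3[OF f])
  moreover have "ev3 (tensor_one_right H J) (\<lambda>a' b' c'. f (a * a') (b * b') (c * c')) =
      sw J (\<lambda>x y. f (a * x) (b * y) c)" for a b c
    by (subst ev3_one_right, intro lin_intros) simp
  moreover have "ev3 (tensor_one_left H J) (\<lambda>a' b' c'. f (a * a') (b * b') (c * c')) =
      sw J (\<lambda>x y. f a (b * x) (c * y))" for a b c
    by (subst ev3_one_left, intro lin_intros) simp
  ultimately have "ev3 (comul_left H J) (\<lambda>a b c. sw J (\<lambda>x y. f (a * x) (b * y) c))
      = ev3 (comul_right H J) (\<lambda>a b c. sw J (\<lambda>x y. f a (b * x) (c * y)))"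
    by simp
  then show ?thesis
    by (subst (asm) ev3_comul_left, intro lin_intros) (subst (asm) ev3_comul_right, intro lin_intros)
qed

lemma rmult_twist_inv:
  assumes f: "trilin f"
  shows "rmult12 J (rmult12 K f) = f" "rmult12 K (rmult12 J f) = f"
    "rmult23 J (rmult23 K f) = f" "rmult23 K (rmult23 J f) = f"
    "rmult_comul_left J (rmult_comul_left K f) = f" "rmult_comul_left K (rmult_comul_left J f) = f"
    "rmult_comul_right J (rmult_comul_right K f) = f" "rmult_comul_right K (rmult_comul_right J f) = f"
proof -
  note [lin_intros] = lin_trilin1[OF f] lin_trilin2[OF f] lin_trilin3[OF f]
  have a: "bilin (\<lambda>x y. f (a * x) (b * y) c)" "bilin (\<lambda>x y. f a (b * x) (c * y))" for a b c
    by (intro lin_intros)+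
  show "rmult12 J (rmult12 K f) = f" "rmult12 K (rmult12 J f) = f"
    "rmult23 J (rmult23 K f) = f" "rmult23 K (rmult23 J f) = f"
    unfolding rmult12_def rmult23_def
    by (intro ext; simp add: mult.assoc sw_twist_inv[OF a(1)] sw_twist_inv[OF a(2)])+
  have b: "bilin (\<lambda>x y. sw (\<Delta> x) (\<lambda>u v. f (a * u) (b * v) (c * y)))"
    "bilin (\<lambda>x y. sw (\<Delta> y) (\<lambda>u v. f (a * x) (b * u) (c * v)))" for a b c
    by (intro lin_intros)+
  have c: "sw (\<Delta> x) (\<lambda>u v. sw X (\<lambda>w z. sw (\<Delta> w) (\<lambda>p q. f (a * u * p) (b * v * q) (c * y * z))))
      = sw X (\<lambda>w z. sw (\<Delta> (x * w)) (\<lambda>u v. f (a * u) (b * v) (c * (y * z))))"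
    "sw (\<Delta> y) (\<lambda>u v. sw X (\<lambda>w z. sw (\<Delta> z) (\<lambda>p q. f (a * x * w) (b * u * p) (c * v * q))))
      = sw X (\<lambda>w z. sw (\<Delta> (y * z)) (\<lambda>u v. f (a * (x * w)) (b * u) (c * v)))" for a b c x y X
    by (subst sw_comul_mult, intro lin_intros, subst sw_swap, simp add: mult.assoc)+
  have d: "sw (\<Delta> 1) (\<lambda>u v. f (a * u) (b * v) (c * 1)) = f a b c"
     "sw (\<Delta> 1) (\<lambda>u v. f (a * 1) (b * u) (c * v)) = f a b c" for a b c
    by (subst sw_comul_one, intro lin_intros, simp)+
  show "rmult_comul_left J (rmult_comul_left K f) = f" "rmult_comul_left K (rmult_comul_left J f) = f"
    "rmult_comul_right J (rmult_comul_right K f) = f" "rmult_comul_right K (rmult_comul_right J f) = f"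
    unfolding rmult_comul_left_def rmult_comul_right_def c
    by (intro ext, simp only: sw_twist_inv[OF b(1)] sw_twist_inv[OF b(2)] d)+
qed

lemma rmult_cocycle:
  assumes f: "trilin f"
  shows "rmult_comul_left J (rmult12 J f) = rmult_comul_right J (rmult23 J f)"
proof (intro ext)
  fix a b c
  note [lin_intros] = lin_trilin1[OF f] lin_trilin2[OF f] lin_trilin3[OF f]
  show "rmult_comul_left J (rmult12 J f) a b c = rmult_comul_right J (rmult23 J f) a b c"
    unfolding rmult12_def rmult23_def rmult_comul_left_def rmult_comul_right_def mult.assoc
    by (rule sw_twist_cocycle) (intro lin_intros)
qed

text \<open>
  Rearrangements of \<open>(\<Delta> \<otimes> id)(J) (J \<otimes> 1) = (id \<otimes> \<Delta>)(J) (1 \<otimes> J)\<close>: the first two isolate a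
  product in which the middle factor mixes \<open>J\<close> and \<open>J\<^sup>-\<^sup>1\<close>, the last is the equation of inverses.
\<close>

lemma rmult_cocycle_consequences:
  assumes f: "trilin f"
  shows "rmult12 J (rmult23 K f) = rmult_comul_left K (rmult_comul_right J f)"
    and "rmult23 J (rmult12 K f) = rmult_comul_right K (rmult_comul_left J f)"
    and "rmult12 K (rmult_comul_left K f) = rmult23 K (rmult_comul_right K f)"
proof -
  note t = f trilin_rmult
  have "rmult12 J (rmult23 K f) = rmult_comul_left K (rmult_comul_left J (rmult12 J (rmult23 K f)))"
    by (simp only: rmult_twist_inv t)
  also have "\<dots> = rmult_comul_left K (rmult_comul_right J f)"
    by (simp only: rmult_cocycle rmult_twist_inv t)
  finally show "rmult12 J (rmult23 K f) = rmult_comul_left K (rmult_comul_right J f)" .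
  have "rmult23 J (rmult12 K f) = rmult_comul_right K (rmult_comul_right J (rmult23 J (rmult12 K f)))"
    by (simp only: rmult_twist_inv t)
  also have "\<dots> = rmult_comul_right K (rmult_comul_left J f)"
    by (simp only: rmult_cocycle[symmetric] rmult_twist_inv t)
  finally show "rmult23 J (rmult12 K f) = rmult_comul_right K (rmult_comul_left J f)" .
  \<comment> \<open>multiply \<open>(\<Delta> \<otimes> id)(J) (J \<otimes> 1)\<close> by \<open>(1 \<otimes> J\<^sup>-\<^sup>1) (id \<otimes> \<Delta>)(J\<^sup>-\<^sup>1)\<close> on one side and by
    \<open>(J\<^sup>-\<^sup>1 \<otimes> 1) (\<Delta> \<otimes> id)(J\<^sup>-\<^sup>1)\<close> on the other\<close>
  define h where "h = rmult12 K (rmult_comul_left K f)"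
  have h: "trilin h"
    unfolding h_def by (intro t)
  have "rmult_comul_left J (rmult12 J h) = f"
    by (simp only: h_def rmult_twist_inv t)
  then have "rmult23 K (rmult_comul_right K f) = rmult23 K (rmult_comul_right K (rmult_comul_right J (rmult23 J h)))"
    by (simp only: rmult_cocycle[OF h])
  also have "\<dots> = h"
    by (simp only: rmult_twist_inv trilin_rmult h)
  finally show "rmult12 K (rmult_comul_left K f) = rmult23 K (rmult_comul_right K f)"
    by (simp only: h_def)
qed

abbreviation "Q \<equiv> twist_Q H J"

text \<open>
  The inverse of \<open>Q\<close>.
\<close>

definition Q' :: 'a
  where "Q' = sw K (\<lambda>x y. x * S y)"

lemma Q_eq: "Q = sw J (\<lambda>x y. S x * y)"
  by (simp add: twist_Q_def sw_def)

text \<open>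
  Apply \<open>S(a) b S(c)\<close> to \<open>(J \<otimes> 1) (1 \<otimes> J\<^sup>-\<^sup>1) = (\<Delta> \<otimes> id)(J\<^sup>-\<^sup>1) (id \<otimes> \<Delta>)(J)\<close>. On the right-hand
  side each coproduct meets its own antipode and everything collapses by normalization.
\<close>

lemma Q_mult_Q': "Q * Q' = 1"
proof -
  let ?f = "\<lambda>a b c. S a * b * S c"
  have "Q * Q' = rmult12 J (rmult23 K ?f) 1 1 1"
    unfolding Q_eq Q'_def sw_mult_left sw_mult_right
    by (subst sw_swap) (simp add: rmult12_def rmult23_def mult.assoc)
  also have "\<dots> = rmult_comul_left K (rmult_comul_right J ?f) 1 1 1"
    by (subst rmult_cocycle_consequences, intro lin_intros) (rule refl)
  also have "\<dots> = sw K (\<lambda>w z. sw (\<Delta> w) (\<lambda>w1 w2. sw J (\<lambda>x y. sw (\<Delta> y) (\<lambda>y1 y2.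
      S x * ((S w1 * w2) * (y1 * S y2)) * S z))))"
    by (simp add: rmult_comul_left_def rmult_comul_right_def antipode_mult antipode_one mult.assoc)
  also have "\<dots> = sw K (\<lambda>w z. sw (\<Delta> w) (\<lambda>w1 w2. sw J (\<lambda>x y. \<epsilon> y \<bullet> (S x * ((S w1 * w2) * 1) * S z))))"
    by (subst sw_antipode_right[where l = "\<lambda>y. S _ * (S _ * _ * y) * S _"], intro lin_intros) (rule refl)
  also have "\<dots> = sw K (\<lambda>w z. sw (\<Delta> w) (\<lambda>w1 w2. S 1 * ((S w1 * w2) * 1) * S z))"
    by (subst sw_twist_counit(2), intro lin_intros) (rule refl)
  also have "\<dots> = sw K (\<lambda>w z. \<epsilon> w \<bullet> (S 1 * (1 * 1) * S z))"
    by (subst sw_antipode_left[where l = "\<lambda>y. S _ * (y * 1) * S _"], intro lin_intros) (rule refl)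
  also have "\<dots> = S 1 * (1 * 1) * S 1"
    by (subst sw_twist_counit(3), intro lin_intros) (rule refl)
  finally show ?thesis by (simp add: antipode_one)
qed

text \<open>
  The same collapse for \<open>a S(b) c\<close> and \<open>(1 \<otimes> J) (J\<^sup>-\<^sup>1 \<otimes> 1) = (id \<otimes> \<Delta>)(J\<^sup>-\<^sup>1) (\<Delta> \<otimes> id)(J)\<close>.
\<close>

lemma Q'_mult_Q: "Q' * Q = 1"
proof -
  let ?f = "\<lambda>a b c. a * S b * c"
  have "Q' * Q = sw J (\<lambda>X Y. sw K (\<lambda>V Z. V * (S Z * S X) * Y))"
    unfolding Q_eq Q'_def sw_mult_left sw_mult_right by (simp add: mult.assoc)
  also have "\<dots> = rmult23 J (rmult12 K ?f) 1 1 1"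
    by (simp add: rmult12_def rmult23_def antipode_mult antipode_one)
  also have "\<dots> = rmult_comul_right K (rmult_comul_left J ?f) 1 1 1"
    by (subst rmult_cocycle_consequences, intro lin_intros) (rule refl)
  also have "\<dots> = sw K (\<lambda>w z. sw (\<Delta> z) (\<lambda>z1 z2. sw J (\<lambda>x y. sw (\<Delta> x) (\<lambda>x1 x2.
      w * ((x1 * S x2) * (S z1 * z2)) * y))))"
    by (simp add: rmult_comul_left_def rmult_comul_right_def antipode_mult antipode_one mult.assoc)
  also have "\<dots> = sw K (\<lambda>w z. sw (\<Delta> z) (\<lambda>z1 z2. sw J (\<lambda>x y. \<epsilon> x \<bullet> (w * (1 * (S z1 * z2)) * y))))"
    by (subst sw_antipode_right[where l = "\<lambda>y. _ * (y * (S _ * _)) * _"], intro lin_intros) (rule refl)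
  also have "\<dots> = sw K (\<lambda>w z. sw (\<Delta> z) (\<lambda>z1 z2. w * (1 * (S z1 * z2)) * 1))"
    by (subst sw_twist_counit(1), intro lin_intros) (rule refl)
  also have "\<dots> = sw K (\<lambda>w z. \<epsilon> z \<bullet> (w * (1 * 1) * 1))"
    by (subst sw_antipode_left[where l = "\<lambda>y. _ * (1 * y) * 1"], intro lin_intros) (rule refl)
  also have "\<dots> = 1 * (1 * 1) * 1"
    by (subst sw_twist_counit(4), intro lin_intros) (rule refl)
  finally show ?thesis by simp
qed

text \<open>
  With the coproduct on the second factor of \<open>J\<close>, which the cocycle equation allows, the
  antipode meets that coproduct and disappears; one copy of \<open>J\<close> then becomes trivial by
  normalization and the other gives \<open>Q\<close>.
\<close>

lemma twist_contract:
  assumes f: "bilin f"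
  shows "sw J (\<lambda>x y. sw (\<Delta> x) (\<lambda>x1 x2. sw J (\<lambda>X Y. f (x1 * X) (S (x2 * Y) * y)))) = f 1 Q"
proof -
  note [lin_intros] = lin_bilin1[OF f] lin_bilin2[OF f]
  have "sw J (\<lambda>x y. sw (\<Delta> x) (\<lambda>x1 x2. sw J (\<lambda>X Y. f (x1 * X) (S (x2 * Y) * y))))
      = sw J (\<lambda>x y. sw (\<Delta> y) (\<lambda>y1 y2. sw J (\<lambda>X Y. f x (S (y1 * X) * (y2 * Y)))))"
    by (rule sw_twist_cocycle, intro lin_intros)
  also have "\<dots> = sw J (\<lambda>x y. sw J (\<lambda>X Y. sw (\<Delta> y) (\<lambda>y1 y2. f x (S X * (S y1 * y2) * Y))))"
    by (subst sw_swap) (simp add: antipode_mult mult.assoc)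
  also have "\<dots> = sw J (\<lambda>x y. sw J (\<lambda>X Y. \<epsilon> y \<bullet> f x (S X * 1 * Y)))"
    by (subst sw_antipode_left[where l = "\<lambda>y. f _ (S _ * y * _)"], intro lin_intros) (rule refl)
  also have "\<dots> = sw J (\<lambda>x y. \<epsilon> y \<bullet> f x Q)"
    unfolding sw_scale Q_eq
    by (subst sw_lin[where l = "f _"], use f in \<open>simp add: bilin_def\<close>) simp
  also have "\<dots> = f 1 Q"
    by (rule sw_twist_counit, intro lin_intros)
  finally show ?thesis .
qed

lemma twist_inv_contract:
  assumes f: "bilin f"
  shows "sw K (\<lambda>V Z. sw K (\<lambda>w z. sw (\<Delta> w) (\<lambda>w1 w2. f (V * w1) (Z * w2 * S z)))) = f 1 Q'"
proof -
  note [lin_intros] = lin_bilin1[OF f] lin_bilin2[OF f]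
  let ?f = "\<lambda>a b c. f a (b * S c)"
  have "sw K (\<lambda>V Z. sw K (\<lambda>w z. sw (\<Delta> w) (\<lambda>w1 w2. f (V * w1) (Z * w2 * S z))))
      = rmult12 K (rmult_comul_left K ?f) 1 1 1"
    by (simp add: rmult12_def rmult_comul_left_def)
  also have "\<dots> = rmult23 K (rmult_comul_right K ?f) 1 1 1"
    by (subst rmult_cocycle_consequences, intro lin_intros) (rule refl)
  also have "\<dots> = sw K (\<lambda>V Z. sw K (\<lambda>w z. sw (\<Delta> z) (\<lambda>z1 z2. f w (V * (z1 * S z2) * S Z))))"
    by (simp add: rmult23_def rmult_comul_right_def antipode_mult antipode_one mult.assoc)
  also have "\<dots> = sw K (\<lambda>V Z. sw K (\<lambda>w z. \<epsilon> z \<bullet> f w (V * 1 * S Z)))"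
    by (subst sw_antipode_right[where l = "\<lambda>y. f _ (_ * y * S _)"], intro lin_intros) (rule refl)
  also have "\<dots> = sw K (\<lambda>V Z. f 1 (V * 1 * S Z))"
    by (subst sw_twist_counit(4), intro lin_intros) (rule refl)
  also have "\<dots> = f 1 Q'"
    unfolding Q'_def
    by (subst sw_lin[where l = "f _"], use f in \<open>simp add: bilin_def\<close>) simp
  finally show ?thesis .
qed

text \<open>
  The known formula \<open>(S \<otimes> S)(J\<^sub>2\<^sub>1) \<Delta>(Q) J = Q \<otimes> Q\<close>. The cocycle equation is used twice: once to
  bring \<open>S(J\<^sub>2\<^sub>1)\<close> and \<open>\<Delta>(S(x))\<close> together, which produces the second factor \<open>Q\<close>, and once
  backwards to produce the first.
\<close>

lemma sw_comul_Q_conjugated: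
  assumes f: "bilin f"
  shows "sw (\<Delta> Q) (\<lambda>a b. sw J (\<lambda>X Y. sw J (\<lambda>V W. f (S Y * a * V) (S X * b * W)))) = f Q Q"
proof -
  note [lin_intros] = lin_bilin1[OF f] lin_bilin2[OF f]
  have l: "lin (\<lambda>a. f a b)" "lin (f a)" for a b
    using f by (simp_all add: bilin_def)
  have "sw (\<Delta> Q) (\<lambda>a b. sw J (\<lambda>X Y. sw J (\<lambda>V W. f (S Y * a * V) (S X * b * W))))
    = sw J (\<lambda>x y. sw (\<Delta> (S x * y)) (\<lambda>a b. sw J (\<lambda>X Y. sw J (\<lambda>V W. f (S Y * a * V) (S X * b * W)))))"
    unfolding Q_eq by (rule sw_comul_sw, intro lin_intros)
  also have "\<dots> = sw J (\<lambda>x y. sw (\<Delta> x) (\<lambda>x1 x2. sw (\<Delta> y) (\<lambda>y1 y2. sw J (\<lambda>X Y. sw J (\<lambda>V W.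
      f (S Y * (S x2 * y1) * V) (S X * (S x1 * y2) * W))))))"
    by (subst sw_comul_mult, intro lin_intros, subst sw_comul_antipode, intro lin_intros) (rule refl)
  also have "\<dots> = sw J (\<lambda>x y. sw (\<Delta> x) (\<lambda>x1 x2. sw J (\<lambda>X Y. sw (\<Delta> y) (\<lambda>y1 y2. sw J (\<lambda>V W.
      f (S (x2 * Y) * y1 * V) (S (x1 * X) * y2 * W))))))"
    by (subst sw_swap[of "\<Delta> _" J]) (simp add: antipode_mult mult.assoc)
  also have "\<dots> = sw J (\<lambda>x y. sw (\<Delta> y) (\<lambda>u v. sw J (\<lambda>X Y. sw (\<Delta> (v * Y)) (\<lambda>y1 y2. sw J (\<lambda>V W.
      f (S (u * X) * y1 * V) (S x * y2 * W))))))"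
    by (rule sw_twist_cocycle, intro lin_intros)
  also have "\<dots> = sw J (\<lambda>x y. sw (\<Delta> y) (\<lambda>u v. sw J (\<lambda>X Y. sw (\<Delta> v) (\<lambda>a b. sw (\<Delta> Y) (\<lambda>c d. sw J (\<lambda>V W.
      f (S X * (S u * a) * c * V) (S x * b * d * W)))))))"
    by (subst sw_comul_mult, intro lin_intros) (simp add: antipode_mult mult.assoc)
  also have "\<dots> = sw J (\<lambda>x y. sw (\<Delta> y) (\<lambda>u v. sw (\<Delta> v) (\<lambda>a b. sw J (\<lambda>X Y. sw (\<Delta> Y) (\<lambda>c d. sw J (\<lambda>V W.
      f (S X * (S u * a) * c * V) (S x * b * d * W)))))))"
    by (rule sw_cong, rule sw_cong, rule sw_swap)
  also have "\<dots> = sw J (\<lambda>x y. sw J (\<lambda>X Y. sw (\<Delta> Y) (\<lambda>c d. sw J (\<lambda>V W.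
      f (S X * 1 * c * V) (S x * y * d * W)))))"
    by (rule sw_cong, rule sw_antipode_left3[where f = "\<lambda>m n. sw J (\<lambda>X Y. sw (\<Delta> Y) (\<lambda>c d. sw J (\<lambda>V W.
      f (S X * m * c * V) (S _ * n * d * W))))"], intro lin_intros)
  also have "\<dots> = sw J (\<lambda>x y. sw J (\<lambda>X Y. sw (\<Delta> Y) (\<lambda>c d. sw J (\<lambda>V W.
      f (S X * (c * V)) (S x * y * (d * W))))))"
    by (simp add: mult.assoc)
  also have "\<dots> = sw J (\<lambda>x y. sw J (\<lambda>X Y. sw (\<Delta> X) (\<lambda>c d. sw J (\<lambda>V W.
      f (S (c * V) * (d * W)) (S x * y * Y)))))"
    by (rule sw_cong, rule sw_twist_cocycle[symmetric], intro lin_intros)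
  also have "\<dots> = sw J (\<lambda>x y. sw J (\<lambda>X Y. sw J (\<lambda>V W. sw (\<Delta> X) (\<lambda>c d.
      f (S V * (S c * d) * W) (S x * y * Y)))))"
    by (subst sw_swap[of "\<Delta> _"]) (simp add: antipode_mult mult.assoc)
  also have "\<dots> = sw J (\<lambda>x y. sw J (\<lambda>X Y. sw J (\<lambda>V W. \<epsilon> X \<bullet> f (S V * 1 * W) (S x * y * Y))))"
    by (subst sw_antipode_left[where l = "\<lambda>m. f (S _ * m * _) (S _ * _ * _)"], intro lin_intros) (rule refl)
  also have "\<dots> = sw J (\<lambda>x y. sw J (\<lambda>X Y. \<epsilon> X \<bullet> f Q (S x * y * Y)))"
    unfolding sw_scale Q_eq
    by (subst sw_lin[where l = "\<lambda>x. f x _"], rule l) simp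
  also have "\<dots> = sw J (\<lambda>x y. f Q (S x * y * 1))"
    by (subst sw_twist_counit(1), intro lin_intros) (rule refl)
  also have "\<dots> = f Q Q"
    by (subst (3) Q_eq, subst sw_lin[where l = "f _"], rule l) simp
  finally show ?thesis .
qed

text \<open>
  The preceding formula, solved for \<open>(S \<otimes> S)(J\<^sub>2\<^sub>1) \<Delta>(Q) = (Q \<otimes> Q) J\<^sup>-\<^sup>1\<close>.
\<close>

lemma sw_comul_Q:
  assumes f: "bilin f"
  shows "sw (\<Delta> Q) (\<lambda>a b. sw J (\<lambda>X Y. f (S Y * a) (S X * b))) = sw K (\<lambda>v z. f (Q * v) (Q * z))"
proof -
  note [lin_intros] = lin_bilin1[OF f] lin_bilin2[OF f]
  have "sw K (\<lambda>v z. f (Q * v) (Q * z))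
      = sw (\<Delta> Q) (\<lambda>a b. sw J (\<lambda>X Y. sw J (\<lambda>V W. sw K (\<lambda>v z. f (S Y * a * (V * v)) (S X * b * (W * z))))))"
    by (subst sw_comul_Q_conjugated[symmetric, where f = "\<lambda>a b. sw K (\<lambda>v z. f (a * v) (b * z))"], intro lin_intros)
      (simp add: mult.assoc)
  also have "\<dots> = sw (\<Delta> Q) (\<lambda>a b. sw J (\<lambda>X Y. f (S Y * a * 1) (S X * b * 1)))"
    by (subst sw_twist_inv(1)[where f = "\<lambda>m n. f (S _ * _ * m) (S _ * _ * n)"], intro lin_intros) (rule refl)
  finally show ?thesis by simp
qed

text \<open>
  The element \<open>J (Q\<^sup>-\<^sup>1 \<otimes> Q\<^sup>-\<^sup>1) (S \<otimes> S)(J\<^sub>2\<^sub>1)\<close> is a left inverse of \<open>\<Delta>(Q)\<close>, so it is \<open>\<Delta>(Q\<^sup>-\<^sup>1)\<close>.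
\<close>

lemma sw_comul_Q':
  assumes f: "bilin f"
  shows "sw (\<Delta> Q') f = sw J (\<lambda>x y. sw J (\<lambda>X Y. f (x * Q' * S Y) (y * Q' * S X)))"
proof -
  note [lin_intros] = lin_bilin1[OF f] lin_bilin2[OF f]
  have one: "sw (\<Delta> Q) (\<lambda>a b. sw (\<Delta> Q') (\<lambda>c d. f (p * (a * c)) (q * (b * d)))) = f p q" for p q
    by (subst sw_comul_mult[symmetric], intro lin_intros, unfold Q_mult_Q', subst sw_comul_one, intro lin_intros) simp
  have "sw J (\<lambda>x y. sw J (\<lambda>X Y. f (x * Q' * S Y) (y * Q' * S X)))
      = sw J (\<lambda>x y. sw J (\<lambda>X Y. sw (\<Delta> Q) (\<lambda>a b. sw (\<Delta> Q') (\<lambda>c d.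
          f (x * Q' * S Y * (a * c)) (y * Q' * S X * (b * d))))))"
    by (simp only: one)
  also have "\<dots> = sw J (\<lambda>x y. sw (\<Delta> Q) (\<lambda>a b. sw J (\<lambda>X Y. sw (\<Delta> Q') (\<lambda>c d.
          f (x * Q' * (S Y * a) * c) (y * Q' * (S X * b) * d)))))"
    by (subst sw_swap[of J "\<Delta> Q"]) (simp add: mult.assoc)
  also have "\<dots> = sw J (\<lambda>x y. sw K (\<lambda>v z. sw (\<Delta> Q') (\<lambda>c d.
          f (x * Q' * (Q * v) * c) (y * Q' * (Q * z) * d))))"
    by (rule sw_cong, rule sw_comul_Q[where f = "\<lambda>m n. sw (\<Delta> Q') (\<lambda>c d. f (_ * Q' * m * c) (_ * Q' * n * d))"],
        intro lin_intros)
  also have "\<dots> = sw J (\<lambda>x y. sw K (\<lambda>v z. sw (\<Delta> Q') (\<lambda>c d.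
          f (x * (Q' * Q) * v * c) (y * (Q' * Q) * z * d))))"
    by (simp only: mult.assoc)
  also have "\<dots> = sw J (\<lambda>x y. sw K (\<lambda>v z. sw (\<Delta> Q') (\<lambda>c d. f (x * v * c) (y * z * d))))"
    by (simp only: Q'_mult_Q mult_1_right)
  also have "\<dots> = sw (\<Delta> Q') (\<lambda>c d. f (1 * c) (1 * d))"
    by (rule sw_twist_inv(1)[where f = "\<lambda>m n. sw (\<Delta> Q') (\<lambda>c d. f (m * c) (n * d))"], intro lin_intros)
  finally show ?thesis by simp
qed

definition g :: 'a
  where "g = S Q' * Q"

text \<open>
  In \<open>\<Delta>(g) = \<Delta>(S(Q\<^sup>-\<^sup>1)) \<Delta>(Q)\<close> the factors \<open>(S \<otimes> S)(J\<^sub>2\<^sub>1)\<close> cancel, which leaves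
  \<open>\<Delta>(g) = (S\<^sup>2 \<otimes> S\<^sup>2)(J) (g \<otimes> g) J\<^sup>-\<^sup>1\<close>.
\<close>

lemma sw_comul_g:
  assumes f: "bilin f"
  shows "sw (\<Delta> g) f = sw J (\<lambda>X Y. sw K (\<lambda>v z. f (S (S X) * g * v) (S (S Y) * g * z)))"
proof -
  note [lin_intros] = lin_bilin1[OF f] lin_bilin2[OF f]
  have "sw (\<Delta> g) f = sw (\<Delta> Q') (\<lambda>a b. sw (\<Delta> Q) (\<lambda>c d. f (S b * c) (S a * d)))"
    unfolding g_def by (subst sw_comul_mult[OF f], subst sw_comul_antipode, intro lin_intros) (rule refl)
  also have "\<dots> = sw J (\<lambda>x y. sw J (\<lambda>X Y. sw (\<Delta> Q) (\<lambda>c d. f (S (y * Q' * S X) * c) (S (x * Q' * S Y) * d))))"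
    by (rule sw_comul_Q', intro lin_intros)
  also have "\<dots> = sw J (\<lambda>X Y. sw (\<Delta> Q) (\<lambda>c d. sw J (\<lambda>x y.
      f (S (S X) * S Q' * (S y * c)) (S (S Y) * S Q' * (S x * d)))))"
    by (subst sw_swap[of J J], subst sw_swap[of J "\<Delta> Q"]) (simp add: antipode_mult mult.assoc)
  also have "\<dots> = sw J (\<lambda>X Y. sw K (\<lambda>v z. f (S (S X) * S Q' * (Q * v)) (S (S Y) * S Q' * (Q * z))))"
    by (rule sw_cong, rule sw_comul_Q[where f = "\<lambda>m n. f (S (S _) * S Q' * m) (S (S _) * S Q' * n)"], intro lin_intros)
  finally show ?thesis
    by (simp add: g_def mult.assoc)
qed

end

section \<open>Right integrals of the twisted Hopf algebra\<close>

locale twisted_integral = hopf_distinguished H \<phi> \<alpha> + hopf_twist H J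
  for H :: "('k::field, 'a::ring_1) hopf" and \<phi> \<alpha> J
begin

abbreviation "R \<equiv> twist_R H J \<alpha>"

text \<open>
  The inverse of \<open>R\<close>: the map \<open>x \<otimes> y \<mapsto> \<alpha>(x) y\<close> is an algebra map, and \<open>R\<close> is the image of \<open>J\<^sup>-\<^sup>1\<close>.
\<close>

definition R' :: 'a
  where "R' = sw J (\<lambda>x y. \<alpha> x \<bullet> y)"

lemma R_eq: "R = sw K (\<lambda>x y. \<alpha> x \<bullet> y)"
  by (simp add: twist_R_def sw_def)

lemma R'_mult_R: "R' * R = 1"
proof -
  have "R' * R = sw J (\<lambda>x y. sw K (\<lambda>v z. \<alpha> (x * v) \<bullet> (y * z)))"
    unfolding R_eq R'_def sw_mult_left sw_mult_right
    by (subst sw_swap) (simp add: smul_mult_left smul_mult_right distinguished_mult mult.commute)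
  also have "\<dots> = \<alpha> 1 \<bullet> 1"
    by (rule sw_twist_inv, intro lin_intros)
  finally show ?thesis
    by (simp add: distinguished_one)
qed

lemma R_mult_R': "R * R' = 1"
proof -
  have "R * R' = sw K (\<lambda>v z. sw J (\<lambda>x y. \<alpha> (v * x) \<bullet> (z * y)))"
    unfolding R_eq R'_def sw_mult_left sw_mult_right
    by (subst sw_swap) (simp add: smul_mult_left smul_mult_right distinguished_mult mult.commute)
  also have "\<dots> = \<alpha> 1 \<bullet> 1"
    by (rule sw_twist_inv, intro lin_intros)
  finally show ?thesis
    by (simp add: distinguished_one)
qed

text \<open>
  Apply \<open>\<alpha>\<close> to the first factor of the cocycle equation.
\<close>

lemma sw_comul_R':
  assumes f: "bilin f"
  shows "sw (\<Delta> R') (\<lambda>a b. sw J (\<lambda>X Y. f (a * X) (b * Y)))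
    = sw J (\<lambda>x y. sw (\<Delta> x) (\<lambda>u v. \<alpha> u \<bullet> f (v * R') y))"
proof -
  note [lin_intros] = lin_bilin1[OF f] lin_bilin2[OF f]
  have "sw (\<Delta> R') (\<lambda>a b. sw J (\<lambda>X Y. f (a * X) (b * Y)))
      = sw J (\<lambda>x y. sw (\<Delta> (\<alpha> x \<bullet> y)) (\<lambda>a b. sw J (\<lambda>X Y. f (a * X) (b * Y))))"
    unfolding R'_def by (rule sw_comul_sw, intro lin_intros)
  also have "\<dots> = sw J (\<lambda>x y. \<alpha> x \<bullet> sw (\<Delta> y) (\<lambda>a b. sw J (\<lambda>X Y. f (a * X) (b * Y))))"
    by (rule sw_cong, rule lin_scale[where l = "\<lambda>x. sw (\<Delta> x) _"], intro lin_intros)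
  also have "\<dots> = sw J (\<lambda>x y. sw (\<Delta> y) (\<lambda>a b. sw J (\<lambda>X Y. \<alpha> x \<bullet> f (a * X) (b * Y))))"
    by (simp only: sw_scale)
  also have "\<dots> = sw J (\<lambda>x y. sw (\<Delta> x) (\<lambda>u v. sw J (\<lambda>X Y. \<alpha> (u * X) \<bullet> f (v * Y) y)))"
    by (rule sw_twist_cocycle[symmetric], intro lin_intros)
  also have "\<dots> = sw J (\<lambda>x y. sw (\<Delta> x) (\<lambda>u v. \<alpha> u \<bullet> f (v * R') y))"
  proof (intro sw_cong)
    fix y u v
    have "f (v * R') y = sw J (\<lambda>X Y. \<alpha> X \<bullet> f (v * Y) y)"
      unfolding R'_def
      by (subst sw_lin[where l = "\<lambda>x. f (v * x) y"], intro lin_intros)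
        (subst lin_scale[where l = "\<lambda>x. f (v * x) y"], intro lin_intros, rule refl)
    then show "sw J (\<lambda>X Y. \<alpha> (u * X) \<bullet> f (v * Y) y) = \<alpha> u \<bullet> f (v * R') y"
      by (simp add: distinguished_mult sw_scale[symmetric])
  qed
  finally show ?thesis .
qed

definition c :: 'a
  where "c = S (S R') * g"

text \<open>
  In \<open>\<Delta>(S\<^sup>2(R\<^sup>-\<^sup>1)) \<Delta>(g)\<close> the factor \<open>(S\<^sup>2 \<otimes> S\<^sup>2)(J)\<close> of \<open>\<Delta>(g)\<close> is exactly what
  \<open>\<Delta>(R\<^sup>-\<^sup>1)\<close> needs for the preceding lemma to apply.
\<close>

lemma sw_comul_c:
  assumes f: "bilin f"
  shows "sw (\<Delta> c) f = sw J (\<lambda>X Y. sw K (\<lambda>v z. f (nakayama X * c * v) (S (S Y) * g * z)))"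
proof -
  note [lin_intros] = lin_bilin1[OF f] lin_bilin2[OF f]
  let ?h = "\<lambda>a b. sw K (\<lambda>v z. f (S (S a) * g * v) (S (S b) * g * z))"
  have "sw (\<Delta> c) f = sw (\<Delta> R') (\<lambda>a b. sw (\<Delta> g) (\<lambda>p q. f (S (S a) * p) (S (S b) * q)))"
    unfolding c_def by (subst sw_comul_mult[OF f], subst sw_comul_antipode, intro lin_intros,
        subst sw_comul_antipode, intro lin_intros) (rule refl)
  also have "\<dots> = sw (\<Delta> R') (\<lambda>a b. sw J (\<lambda>X Y. ?h (a * X) (b * Y)))"
    by (subst sw_comul_g, intro lin_intros) (simp add: antipode_mult mult.assoc)
  also have "\<dots> = sw J (\<lambda>x y. sw (\<Delta> x) (\<lambda>u v. \<alpha> u \<bullet> ?h (v * R') y))"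
    by (rule sw_comul_R', intro lin_intros)
  also have "\<dots> = sw J (\<lambda>x y. sw (\<Delta> x) (\<lambda>u v. \<alpha> u \<bullet> sw K (\<lambda>p q. f (S (S v) * c * p) (S (S y) * g * q))))"
    by (simp add: c_def antipode_mult mult.assoc)
  also have "\<dots> = sw J (\<lambda>x y. sw K (\<lambda>p q. f (nakayama x * c * p) (S (S y) * g * q)))"
    by (rule sw_cong, rule sw_distinguished_antipode[where l = "\<lambda>m. sw K (\<lambda>p q. f (m * c * p) (S (S _) * g * q))"],
        intro lin_intros)
  finally show ?thesis .
qed

lemma right_integral_twisted: "right_integral_dual (twisted_hopf H J) (hit \<phi> c)"
proof -
  have lin: "functional (hit \<phi> c)"
    by (rule functionalI) (simp_all add: hit_def distrib_left smul_mult_right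
        functional_add[OF functional_integral] functional_scale[OF functional_integral])
  note [lin_intros] = lin_functional[OF lin]
  have swap3: "sw W (\<lambda>u v. sw J (\<lambda>x y. sw (\<Delta> x) (\<lambda>p q. sw J (\<lambda>X Y. F u v x y p q X Y))))
      = sw J (\<lambda>x y. sw (\<Delta> x) (\<lambda>p q. sw J (\<lambda>X Y. sw W (\<lambda>u v. F u v x y p q X Y))))" for W F
    by (subst sw_swap, rule sw_cong, subst sw_swap, rule sw_cong, rule sw_swap)
  have "sw (mult2 (smul H) (mult2 (smul H) K (\<Delta> b)) J) (\<lambda>x y. hit \<phi> c x \<bullet> y) = hit \<phi> c b \<bullet> 1" for b
  proof -
    let ?P = "sw (mult2 (smul H) (mult2 (smul H) K (\<Delta> b)) J) (\<lambda>x y. hit \<phi> c x \<bullet> y)"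
    have "?P = sw K (\<lambda>w z. sw (\<Delta> b) (\<lambda>u v. sw J (\<lambda>x y. \<phi> (c * (w * u * x)) \<bullet> (z * v * y))))"
      by (subst sw_mult2, intro lin_intros, subst sw_mult2, intro lin_intros) (simp add: hit_def)
    also have "\<dots> = sw K (\<lambda>w z. sw (\<Delta> b) (\<lambda>u v. sw J (\<lambda>x y. \<phi> (nakayama x * c * w * u) \<bullet> (z * v * y))))"
      by (simp add: mult.assoc[symmetric] integral_mult_commute[of "c * _ * _"])
    \<comment> \<open>applying \<open>S\<close> turns \<open>b\<^sub>2\<close> into \<open>S(b\<^sub>2)\<close>, as needed to move the coproduct off \<open>b\<close>\<close>
    finally have "S ?P = sw K (\<lambda>w z. sw (\<Delta> b) (\<lambda>u v. sw J (\<lambda>x y.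
        \<phi> (nakayama x * c * w * u) \<bullet> (S y * S v * S z))))"
      by (simp add: sw_lin[OF lin_antipode[OF lin_id]] lin_scale[OF lin_antipode[OF lin_id]] antipode_mult mult.assoc)
    also have "\<dots> = sw K (\<lambda>w z. sw J (\<lambda>x y. sw (\<Delta> b) (\<lambda>u v.
        \<phi> (nakayama x * c * w * u) \<bullet> (S y * S v * S z))))"
      by (rule sw_cong, rule sw_swap)
    also have "\<dots> = sw K (\<lambda>w z. sw J (\<lambda>x y. sw (\<Delta> (nakayama x * c * w)) (\<lambda>p q. \<phi> (p * b) \<bullet> (S y * q * S z))))"
      by (intro sw_cong, rule sw_integral_left[where l = "\<lambda>q. S _ * q * S _"], intro lin_intros)
    also have "\<dots> = sw K (\<lambda>w z. sw J (\<lambda>x y. sw (\<Delta> x) (\<lambda>x1 x2. sw J (\<lambda>X Y. sw K (\<lambda>V Z. sw (\<Delta> w) (\<lambda>w1 w2.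
        \<phi> (nakayama x1 * (nakayama X * c * V) * w1 * b) \<bullet> (S y * (S (S x2) * (S (S Y) * g * Z) * w2) * S z)))))))"
      by (subst sw_comul_mult, intro lin_intros, subst sw_comul_mult, intro lin_intros,
        subst sw_comul_nakayama, intro lin_intros, subst sw_comul_c, intro lin_intros, rule refl)
    also have "\<dots> = sw K (\<lambda>w z. sw K (\<lambda>V Z. sw J (\<lambda>x y. sw (\<Delta> x) (\<lambda>x1 x2. sw J (\<lambda>X Y. sw (\<Delta> w) (\<lambda>w1 w2.
        \<phi> (nakayama x1 * (nakayama X * c * V) * w1 * b) \<bullet> (S y * (S (S x2) * (S (S Y) * g * Z) * w2) * S z)))))))"
      by (rule sw_cong, rule swap3[symmetric])
    also have "\<dots> = sw K (\<lambda>w z. sw K (\<lambda>V Z. sw (\<Delta> w) (\<lambda>w1 w2. sw J (\<lambda>x y. sw (\<Delta> x) (\<lambda>x1 x2. sw J (\<lambda>X Y.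
        \<phi> (nakayama x1 * (nakayama X * c * V) * w1 * b) \<bullet> (S y * (S (S x2) * (S (S Y) * g * Z) * w2) * S z)))))))"
      by (rule sw_cong, rule sw_cong, rule swap3[symmetric])
    also have "\<dots> = sw K (\<lambda>w z. sw K (\<lambda>V Z. sw (\<Delta> w) (\<lambda>w1 w2. sw J (\<lambda>x y. sw (\<Delta> x) (\<lambda>x1 x2. sw J (\<lambda>X Y.
        \<phi> (nakayama (x1 * X) * c * (V * w1) * b) \<bullet> (S (S (x2 * Y) * y) * g * (Z * w2 * S z))))))))"
      by (simp add: nakayama_mult antipode_mult mult.assoc)
    also have "\<dots> = sw K (\<lambda>w z. sw K (\<lambda>V Z. sw (\<Delta> w) (\<lambda>w1 w2.
        \<phi> (nakayama 1 * c * (V * w1) * b) \<bullet> (S Q * g * (Z * w2 * S z)))))"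
      by (subst twist_contract[where f = "\<lambda>m n. \<phi> (nakayama m * c * (_ * _) * b) \<bullet> (S n * g * (_ * _ * S _))"],
          intro lin_intros) (rule refl)
    also have "\<dots> = sw K (\<lambda>V Z. sw K (\<lambda>w z. sw (\<Delta> w) (\<lambda>w1 w2.
        \<phi> (nakayama 1 * c * (V * w1) * b) \<bullet> (S Q * g * (Z * w2 * S z)))))"
      by (rule sw_swap)
    also have "\<dots> = \<phi> (nakayama 1 * c * 1 * b) \<bullet> (S Q * g * Q')"
      by (rule twist_inv_contract[where f = "\<lambda>m n. \<phi> (nakayama 1 * c * m * b) \<bullet> (S Q * g * n)"], intro lin_intros)
    also have "S Q * g * Q' = S (Q' * Q) * (Q * Q')"
      by (simp only: g_def antipode_mult mult.assoc)
    also have "\<dots> = 1"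
      by (simp add: Q_mult_Q' Q'_mult_Q antipode_one)
    also have "\<phi> (nakayama 1 * c * 1 * b) \<bullet> 1 = S (hit \<phi> c b \<bullet> 1)"
      by (simp add: nakayama_one hit_def lin_scale[OF lin_antipode[OF lin_id]] antipode_one)
    finally show ?thesis
      by (rule antipode_inj)
  qed
  then show ?thesis
    using lin by (simp add: right_integral_dual_def twisted_hopf_def functional_def sw_def)
qed

lemma inv_ring_monoid:
  assumes "x * y = 1" "y * x = (1::'a)"
  shows "inv\<^bsub>ring_monoid\<^esub> x = y"
proof -
  interpret M: monoid "ring_monoid :: 'a monoid"
    by (rule monoidI) (simp_all add: ring_monoid_def mult.assoc)
  show ?thesis
    by (rule M.inv_unique'[symmetric]) (use assms in \<open>simp_all add: ring_monoid_def\<close>)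
qed

lemma twisted_integral_nonzero: "hit \<phi> c \<noteq> (\<lambda>_. 0)"
proof
  assume zero: "hit \<phi> c = (\<lambda>_. 0)"
  have inv: "c * (Q' * S Q * S (S R)) = 1"
  proof -
    have "c * (Q' * S Q * S (S R)) = S (S R') * (S Q' * (Q * Q') * S Q) * S (S R)"
      by (simp add: c_def g_def mult.assoc)
    also have "\<dots> = S (S R') * S (Q * Q') * S (S R)"
      by (simp only: antipode_mult) (simp add: Q_mult_Q')
    also have "\<dots> = S (S (R' * R))"
      by (simp add: Q_mult_Q' antipode_mult antipode_one)
    finally show ?thesis
      by (simp add: R'_mult_R antipode_one)
  qed
  have "\<phi> b = 0" for b
  proof -
    have "\<phi> (c * (Q' * S Q * S (S R) * b)) = 0"
      using zero by (simp add: hit_def fun_eq_iff)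
    then show ?thesis
      by (simp add: mult.assoc[symmetric] inv[simplified mult.assoc[symmetric]])
  qed
  with nonzero show False
    by (simp add: fun_eq_iff)
qed

end

theorem theorem5p1:
  fixes H :: "('k::field, 'a::ring_1) hopf"
    and J :: "('k, 'a) tensor2"
    and \<alpha> \<phi> :: "'a \<Rightarrow> 'k"
  assumes "finite_dimensional_hopf_algebra H"
    and "normalized_twist H J"
    and "distinguished_grouplike H \<alpha>"
    and "right_integral_dual H \<phi>"
    and "\<phi> \<noteq> (\<lambda>_. 0)"
  shows "let S = antipode H;
             Q = twist_Q H J;
             R = twist_R H J \<alpha>;
             \<phi>J = hit \<phi> (S (S (inv\<^bsub>ring_monoid\<^esub> R)) * S (inv\<^bsub>ring_monoid\<^esub> Q) * Q)
         in right_integral_dual (twisted_hopf H J) \<phi>J \<and> \<phi>J \<noteq> (\<lambda>_. 0)"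
proof -
  interpret finite_dimensional_hopf_algebra H by fact
  interpret twisted_integral H \<phi> \<alpha> J
    by unfold_locales (use assms in auto)
  have "inv\<^bsub>ring_monoid\<^esub> R = R'" "inv\<^bsub>ring_monoid\<^esub> Q = Q'"
    by (simp_all add: inv_ring_monoid R_mult_R' R'_mult_R Q_mult_Q' Q'_mult_Q)
  then have "S (S (inv\<^bsub>ring_monoid\<^esub> R)) * S (inv\<^bsub>ring_monoid\<^esub> Q) * Q = c"
    by (simp add: c_def g_def mult.assoc)
  then show ?thesis
    using right_integral_twisted twisted_integral_nonzero by (simp add: Let_def)
qed

end
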